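(* Let $H$ be a graph with chromatic number $r+1\ge 3$. Then there is a least positive integer $g$ such that $H$ is not homomorphic to $K_{r-2}+C_{2g+1}$, and furthermore \[ 1-\frac{1}{r-1} < 1-\frac{1}{r-1+2/(2g-1)} \le \delta_H \le 1-\frac{1}{r-1/3}. \]
   Context: All graphs are finite and simple. $K_m$ is the complete graph on $m$ vertices ($K_0$ is empty), $C_m$ the $m$-cycle; the join $G+F$ is obtained from disjoint copies of $G$ and $F$ by joining every vertex of $G$ to every vertex of $F$. $H$ is homomorphic to $F$ if there is a map $V(H)\to V(F)$ sending edges to edges. $\delta(G)$ is minimum degree; $G$ is $H$-free if it contains no subgraph isomorphic to $H$. For a graph $H$ of chromatic number $r+1$, $\delta_H$ is the infimum of all $c$ such that for every $\eta>0$ there is $n_0$ such that every $H$-free graph $G$ on $n\ge n_0$ vertices with $\delta(G)\ge cn$ can be made $r$-partite by deleting at most $\eta n^2$ edges. *)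

theory Defs
  imports Complex_Main "HOL-Library.Ramsey"
begin

record 'a graph =
  verts :: "'a set"
  edges :: "'a set set"

definition simple_graph :: "'a graph \<Rightarrow> bool" where
  "simple_graph G \<longleftrightarrow> finite (verts G) \<and> edges G \<subseteq> nsets (verts G) 2"

definition complete_graph :: "nat \<Rightarrow> nat graph" where
  "complete_graph m = \<lparr>verts = {..<m}, edges = nsets {..<m} 2\<rparr>"

text \<open>The \<open>m\<close>-cycle, meaningful for \<open>m \<ge> 3\<close>.\<close>

definition cycle_graph :: "nat \<Rightarrow> nat graph" where
  "cycle_graph m = \<lparr>verts = {..<m}, edges = {{i, (i + 1) mod m} | i. i < m}\<rparr>"

definition graph_join :: "'a graph \<Rightarrow> 'b graph \<Rightarrow> ('a + 'b) graph" where
  "graph_join G F = \<lparr>verts = verts G <+> verts F,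
     edges = (image Inl) ` edges G \<union> (image Inr) ` edges F
       \<union> {{Inl u, Inr v} | u v. u \<in> verts G \<and> v \<in> verts F}\<rparr>"

definition homomorphic :: "'a graph \<Rightarrow> 'b graph \<Rightarrow> bool" where
  "homomorphic H F \<longleftrightarrow>
     (\<exists>f. f ` verts H \<subseteq> verts F \<and> (\<forall>u v. {u, v} \<in> edges H \<longrightarrow> {f u, f v} \<in> edges F))"

definition isomorphic :: "'a graph \<Rightarrow> 'b graph \<Rightarrow> bool" where
  "isomorphic H F \<longleftrightarrow>
     (\<exists>f. bij_betw f (verts H) (verts F) \<and>
          (\<forall>u\<in>verts H. \<forall>v\<in>verts H. {u, v} \<in> edges H \<longleftrightarrow> {f u, f v} \<in> edges F))"

definition subgraph_of :: "'a graph \<Rightarrow> 'a graph \<Rightarrow> bool" where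
  "subgraph_of F G \<longleftrightarrow> simple_graph F \<and> verts F \<subseteq> verts G \<and> edges F \<subseteq> edges G"

definition graph_free :: "'a graph \<Rightarrow> 'b graph \<Rightarrow> bool" where
  "graph_free H G \<longleftrightarrow> \<not> (\<exists>F. subgraph_of F G \<and> isomorphic H F)"

definition degree :: "'a graph \<Rightarrow> 'a \<Rightarrow> nat" where
  "degree G v = card {u \<in> verts G. {u, v} \<in> edges G}"

definition min_degree :: "'a graph \<Rightarrow> nat" where
  "min_degree G = Min (degree G ` verts G)"

text \<open>Colour classes are allowed to be empty.\<close>

definition partite :: "nat \<Rightarrow> 'a graph \<Rightarrow> bool" where
  "partite k G \<longleftrightarrow>
     (\<exists>c. c ` verts G \<subseteq> {..<k} \<and> (\<forall>u v. {u, v} \<in> edges G \<longrightarrow> c u \<noteq> c v))"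

definition chromatic_number :: "'a graph \<Rightarrow> nat" where
  "chromatic_number G = (LEAST k. partite k G)"

definition partite_after_deleting :: "nat \<Rightarrow> real \<Rightarrow> 'a graph \<Rightarrow> bool" where
  "partite_after_deleting r m G \<longleftrightarrow>
     (\<exists>D \<subseteq> edges G. real (card D) \<le> m \<and> partite r (G\<lparr>edges := edges G - D\<rparr>))"

text \<open>
  Every finite graph is isomorphic to one with vertices in \<^typ>\<open>nat\<close>, so
  host graphs \<open>G\<close> range over \<^typ>\<open>nat graph\<close>. The number \<open>r\<close> of parts is one less than the
  chromatic number of \<open>H\<close>. The value of \<^const>\<open>min_degree\<close> at the graph without vertices
  is irrelevant, since that graph is \<open>r\<close>-partite.
\<close>

definition delta_threshold :: "'a graph \<Rightarrow> real" where
  "delta_threshold H = Inf {c :: real. \<forall>\<eta>>0. \<exists>n\<^sub>0 :: nat. \<forall>G :: nat graph.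
     simple_graph G \<longrightarrow> graph_free H G \<longrightarrow> card (verts G) \<ge> n\<^sub>0 \<longrightarrow>
     real (min_degree G) \<ge> c * real (card (verts G)) \<longrightarrow>
     partite_after_deleting (chromatic_number H - 1) (\<eta> * (real (card (verts G)))\<^sup>2) G}"

end

theory Submission
  imports Defs "HOL-Library.Countable"
begin

text \<open>
  Lower bound: a suitably weighted blow-up of \<open>K\<^sub>r\<^sub>-\<^sub>2 + C\<^sub>2\<^sub>g\<^sub>+\<^sub>1\<close> is \<open>H\<close>-free, regular of the claimed density
  and, since \<open>K\<^sub>r\<^sub>-\<^sub>2 + C\<^sub>2\<^sub>g\<^sub>+\<^sub>1\<close> is not \<open>r\<close>-partite, far from being \<open>r\<close>-partite.

  Upper bound: an \<open>H\<close>-free graph contains no large complete \<open>(r + 1)\<close>-partite subgraph, hence by Erdos'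
  theorem only few copies of \<open>K\<^sub>r\<^sub>+\<^sub>1\<close>. Instead of the removal lemma, a random sample of bounded size is
  used: together with two further random vertices \<open>u\<close>, \<open>v\<close> it typically spans a graph without
  \<open>K\<^sub>r\<^sub>+\<^sub>1\<close> whose minimum degree exceeds the Andrasfai-Erdos-Sos bound, and is therefore \<open>r\<close>-partite. The
  \<open>r\<close>-colouring of the sample is unique up to renaming, so it determines the colour of each typical
  vertex of the whole graph, and a typical edge \<open>uv\<close> receives two different colours.
\<close>

section \<open>Minimum degree and r-partite graphs\<close>

text \<open>The constant is the Andrasfai-Erdos-Sos bound in complementary form: since
  \<open>1 / (r - 1/3) = 3 / (3 * r - 1)\<close>, it says that every vertex has less than this
  proportion of the vertices as non-neighbours, itself included. Hence the recurring hypothesis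
  \<open>(3 * r - 1) * m < 3 * card V\<close>, which persists with the same \<open>m\<close> in
  neighbourhoods with one colour fewer. The threshold only asks for few deletions, so it suffices to
  colour the vertices with few monochromatic edges; this is why a sample of size independent of
  \<open>n\<close> can decide the colours. Only densities strictly above the bound are treated: the
  slack pays for the deviation of sampled degrees, and an infimum does not see the boundary value.
  The obstacle is that the colouring of the sample found together with \<open>u\<close> and
  \<open>v\<close> depends on that pair. Uniqueness makes all these colourings comparable with one
  fixed in advance. In the blow-up every vertex misses weight \<open>2 * g - 1\<close> out of
  \<open>(r - 1) * (2 * g - 1) + 2\<close>, which is the origin of
  \<open>2 / (2 * g - 1)\<close>.\<close>

text \<open>Brandt's argument. Take the cliques \<open>A1\<close>, \<open>A2\<close> witnessing maximality at the non-edges \<open>y x1\<close>,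
  \<open>y x2\<close> with \<open>A1 \<inter> A2\<close> as large as possible. Counting vertices of \<open>A1 \<inter> A2\<close> three times and the others
  once, every vertex misses weight at least 3 out of at most \<open>3 * r - 1\<close>: a vertex missing only one
  element of each of \<open>A1\<close>, \<open>A2\<close> could be exchanged into both.\<close>

lemma brandt_transitive:
  fixes E :: "'b \<Rightarrow> 'b \<Rightarrow> bool"
  assumes fin: "finite V" and sym: "symp E" and irr: "irreflp E"
    and cl: "\<And>K. K \<subseteq> V \<Longrightarrow> pairwise E K \<Longrightarrow> card K \<le> r"
    and maxi: "\<And>x y. x \<in> V \<Longrightarrow> y \<in> V \<Longrightarrow> x \<noteq> y \<Longrightarrow> \<not> E x y \<Longrightarrow>
       \<exists>A \<subseteq> V. Suc (card A) = r \<and> pairwise E A \<and> (\<forall>a\<in>A. E x a \<and> E y a)"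
    and deg: "\<And>v. v \<in> V \<Longrightarrow> card {u \<in> V. \<not> E v u} \<le> m" and m: "(3 * r - 1) * m < 3 * card V"
    and V: "x1 \<in> V" "x2 \<in> V" "y \<in> V" and non: "\<not> E y x1" "\<not> E y x2"
  shows "\<not> E x1 x2"
proof
  assume x12: "E x1 x2"
  have E_sym: "E v u" if "E u v" for u v using sym that by (auto dest: sympD)
  have E_irr: "\<not> E u u" for u using irr by (auto dest: irreflpD)
  have ne: "x1 \<noteq> x2" "y \<noteq> x1" "y \<noteq> x2"
    using x12 non E_irr E_sym by blast+
  define ok where "ok x A \<longleftrightarrow> A \<subseteq> V \<and> Suc (card A) = r \<and> pairwise E A \<and> (\<forall>a\<in>A. E y a \<and> E x a)" for x A
  have "\<exists>A. ok x1 A" "\<exists>A. ok x2 A"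
    using maxi[OF V(3) V(1)] maxi[OF V(3) V(2)] ne non unfolding ok_def by blast+
  then obtain B1 B2 where B: "ok x1 B1" "ok x2 B2" by blast
  define P where "P p \<longleftrightarrow> ok x1 (fst p) \<and> ok x2 (snd p)" for p
  have finA: "finite A" if "ok x A" for x A using that fin finite_subset unfolding ok_def by blast
  have "\<exists>p. P p \<and> (\<forall>q. P q \<longrightarrow> card (fst q \<inter> snd q) \<le> card (fst p \<inter> snd p))"
  proof (rule ex_has_greatest_nat[where k = "(B1, B2)" and b = "Suc (card V)"])
    show "P (B1, B2)" using B by (simp add: P_def)
    show "\<forall>q. P q \<longrightarrow> card (fst q \<inter> snd q) < Suc (card V)"
      unfolding P_def ok_def less_Suc_eq_le by (auto intro!: card_mono fin)
  qed
  then obtain A1 A2 where A: "ok x1 A1" "ok x2 A2"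
    and best: "\<And>C1 C2. ok x1 C1 \<Longrightarrow> ok x2 C2 \<Longrightarrow> card (C1 \<inter> C2) \<le> card (A1 \<inter> A2)"
    unfolding P_def by fastforce
  have A1: "A1 \<subseteq> V" "Suc (card A1) = r" "pairwise E A1" "\<And>a. a \<in> A1 \<Longrightarrow> E y a" "\<And>a. a \<in> A1 \<Longrightarrow> E x1 a"
   and A2: "A2 \<subseteq> V" "Suc (card A2) = r" "pairwise E A2" "\<And>a. a \<in> A2 \<Longrightarrow> E y a" "\<And>a. a \<in> A2 \<Longrightarrow> E x2 a"
    using A unfolding ok_def by auto
  have fA: "finite A1" "finite A2" using A finA by auto
  have nin: "x1 \<notin> A1" "x1 \<notin> A2" "x2 \<notin> A1" "x2 \<notin> A2" "y \<notin> A1" "y \<notin> A2"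
    using A1 A2 E_irr non by blast+
  define K where "K = A1 \<inter> A2"
  define W where "W = A1 \<union> A2 \<union> {x1, x2, y}"
  have K_sub: "K \<subseteq> W" "K \<subseteq> V" and WV: "W \<subseteq> V" using A1 A2 V unfolding K_def W_def by auto
  have finW: "finite W" "finite K" using fA by (auto simp: W_def K_def)
  \<comment> \<open>An \<open>r\<close>-clique \<open>insert x A\<close> cannot lie in the
    neighbourhood of any \<open>v\<close>. The missed element may be \<open>v\<close> itself, as
    \<open>E\<close> is irreflexive.\<close>
  have miss: "\<exists>a\<in>insert x A. \<not> E v a"
    if "v \<in> V" "x \<in> V" "A \<subseteq> V" "finite A" "Suc (card A) = r" "pairwise E A" "x \<notin> A" "\<And>a. a \<in> A \<Longrightarrow> E x a" for v x A
  proof (rule ccontr)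
    assume *: "\<not> ?thesis"
    have "v \<notin> insert x A" using * E_irr by blast
    then have "card (insert v (insert x A)) = r + 1" using that by simp
    moreover have "pairwise E (insert v (insert x A))"
      using * that E_sym by (auto simp: pairwise_insert)
    ultimately show False using cl[of "insert v (insert x A)"] that by auto
  qed
  have K_small: "card K + 2 \<le> r"
  proof -
    have "A1 \<noteq> A2"
    proof
      assume "A1 = A2"
      then have "\<And>a. a \<in> insert x1 A1 \<Longrightarrow> E x2 a" using A2 x12 E_sym by blast
      then show False using miss[of x2 x1 A1] A1 V fA nin by blast
    qed
    then have "K \<subset> A1" using card_subset_eq[of A1 A2] card_subset_eq[of A2 A1] A1(2) A2(2) fA
      unfolding K_def by (metis Suc_inject inf.absorb_iff1 inf_le1 psubsetI)
    then have "card K < card A1" using fA by (simp add: psubset_card_mono)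
    then show ?thesis using A1 by simp
  qed
  \<comment> \<open>The total weight is \<open>card W + 2 * card K = 2 * r + 1 + card K\<close>, and
    \<open>card K + 2 \<le> r\<close> turns it into the \<open>3 * r - 1\<close> of the
    hypothesis.\<close>
  have cardW: "card W + card K = 2 * r + 1"
  proof -
    have "card W = card (A1 \<union> A2) + 3" unfolding W_def using ne nin fA by (simp add: card_Un_disjoint)
    moreover have "card A1 + card A2 = card (A1 \<union> A2) + card K"
      unfolding K_def by (rule card_Un_Int) (use fA in auto)
    ultimately show ?thesis using A1(2) A2(2) by simp
  qed
  have three: "card {w \<in> W. \<not> E v w} + 2 * card {w \<in> K. \<not> E v w} \<ge> 3" if v: "v \<in> V" for v
  proof (cases "{w \<in> K. \<not> E v w} = {}")
    case False
    then have "{w \<in> W. \<not> E v w} \<noteq> {}" using K_sub by blast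
    then have "card {w \<in> W. \<not> E v w} \<ge> 1" "card {w \<in> K. \<not> E v w} \<ge> 1"
      using False finW by (simp_all add: Suc_le_eq card_gt_0_iff)
    then show ?thesis by linarith
  next
    case True
    then have vK: "\<And>w. w \<in> K \<Longrightarrow> E v w" by blast
    define M where "M = {w \<in> W. \<not> E v w}"
    have "card M \<ge> 3"
    proof (rule ccontr)
      assume small: "\<not> card M \<ge> 3"
      obtain a where a: "a \<in> insert x1 A1" "\<not> E v a"
        using miss[of v x1 A1] v V A1 fA nin by blast
      obtain b where b: "b \<in> insert x2 A2" "\<not> E v b"
        using miss[of v x2 A2] v V A2 fA nin by blast
      have ab: "a \<noteq> b" using a b vK nin ne unfolding K_def by auto
      have sub: "{a, b} \<subseteq> M" using a b unfolding M_def W_def by auto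
      have Mab: "M = {a, b}"
        using card_seteq[of M "{a,b}"] sub small ab finW unfolding M_def by simp
      \<comment> \<open>As \<open>y\<close> is adjacent to \<open>v\<close>, the cliques
        \<open>insert y A1\<close> and \<open>insert y A2\<close> force the two missed vertices into
        \<open>A1\<close> and \<open>A2\<close>. Thus \<open>x1\<close> and \<open>x2\<close> are
        adjacent to \<open>v\<close>, and the exchange is possible.\<close>
      have ynM: "y \<notin> M" using Mab a b nin ne by auto
      then have vy: "E v y" unfolding M_def W_def by auto
      obtain a' where a': "a' \<in> insert y A1" "\<not> E v a'"
        using miss[of v y A1] v V A1 fA nin by blast
      obtain b' where b': "b' \<in> insert y A2" "\<not> E v b'"
        using miss[of v y A2] v V A2 fA nin by blast
      have aA: "a' \<in> A1" "b' \<in> A2" using a' b' vy by auto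
      then have "a' \<in> M" "b' \<in> M" using a' b' unfolding M_def W_def by auto
      then have "a' = a" "b' = b" using Mab aA a b a' b' vK nin unfolding K_def by auto
      then have aA: "a \<in> A1" "b \<in> A2" using aA by auto
      have bn: "b \<notin> A1" "a \<notin> A2" using aA a b vK unfolding K_def by auto
      have adj: "E v w" if "w \<in> W" "w \<noteq> a" "w \<noteq> b" for w using that Mab unfolding M_def by blast
      have "v \<notin> W \<or> v = a \<or> v = b" using adj E_irr by blast
      then have vn: "v \<notin> A1 - {a}" "v \<notin> A2 - {b}" using bn unfolding W_def by auto
      have "ok x1 (insert v (A1 - {a}))"
      proof -
        have "E y v" using vy E_sym by blast
        moreover have "E x1 v" using adj[of x1] aA bn nin E_sym unfolding W_def by blast
        moreover have "pairwise E (insert v (A1 - {a}))"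
        proof -
          have "E v w \<and> E w v" if "w \<in> A1 - {a}" for w
            using adj[of w] that bn E_sym unfolding W_def by blast
          then show ?thesis using A1(3) pairwise_subset[of E A1 "A1 - {a}"]
            unfolding pairwise_insert by blast
        qed
        moreover have "Suc (card (insert v (A1 - {a}))) = r"
          using vn fA A1(2) card_Suc_Diff1[OF fA(1) aA(1)] by simp
        ultimately show ?thesis using A1 v unfolding ok_def by auto
      qed
      moreover have "ok x2 (insert v (A2 - {b}))"
      proof -
        have "E y v" using vy E_sym by blast
        moreover have "E x2 v" using adj[of x2] aA bn nin E_sym unfolding W_def by blast
        moreover have "pairwise E (insert v (A2 - {b}))"
        proof -
          have "E v w \<and> E w v" if "w \<in> A2 - {b}" for w
            using adj[of w] that bn E_sym unfolding W_def by blast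
          then show ?thesis using A2(3) pairwise_subset[of E A2 "A2 - {b}"]
            unfolding pairwise_insert by blast
        qed
        moreover have "Suc (card (insert v (A2 - {b}))) = r"
          using vn fA A2(2) card_Suc_Diff1[OF fA(2) aA(2)] by simp
        ultimately show ?thesis using A2 v unfolding ok_def by auto
      qed
      ultimately have le: "card (insert v (A1 - {a}) \<inter> insert v (A2 - {b})) \<le> card K"
        using best unfolding K_def by blast
      have "insert v K \<subseteq> insert v (A1 - {a}) \<inter> insert v (A2 - {b})"
        using bn unfolding K_def by auto
      then have "card (insert v K) \<le> card (insert v (A1 - {a}) \<inter> insert v (A2 - {b}))"
        using fA by (intro card_mono) auto
      moreover have "v \<notin> K" using vK E_irr by blast
      ultimately show False using le finW by simp
    qed
    then show ?thesis unfolding M_def by simp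
  qed
  have swap: "(\<Sum>v\<in>V. card {w \<in> Z. \<not> E v w}) = (\<Sum>w\<in>Z. card {v \<in> V. \<not> E w v})" if "Z \<subseteq> V" for Z
  proof -
    have fZ: "finite Z" using that fin finite_subset by blast
    have "(\<Sum>v\<in>V. card {w \<in> Z. \<not> E v w}) = (\<Sum>v\<in>V. \<Sum>w\<in>Z. if E v w then 0 else 1)"
      using fZ by (intro sum.cong refl) (simp add: sum.If_cases Int_def)
    also have "\<dots> = (\<Sum>w\<in>Z. \<Sum>v\<in>V. if E w v then 0 else 1)"
      by (subst sum.swap) (intro sum.cong refl, use E_sym in auto)
    also have "\<dots> = (\<Sum>w\<in>Z. card {v \<in> V. \<not> E w v})"
      using fin by (intro sum.cong refl) (simp add: sum.If_cases Int_def)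
    finally show ?thesis .
  qed
  have le: "(\<Sum>w\<in>Z. card {v \<in> V. \<not> E w v}) \<le> card Z * m" if "Z \<subseteq> V" for Z
    using sum_bounded_above[of Z "\<lambda>w. card {v \<in> V. \<not> E w v}" m] deg that by auto
  have "3 * card V \<le> (\<Sum>v\<in>V. card {w \<in> W. \<not> E v w} + 2 * card {w \<in> K. \<not> E v w})"
    using sum_bounded_below[of V 3 "\<lambda>v. card {w \<in> W. \<not> E v w} + 2 * card {w \<in> K. \<not> E v w}"] three
    by (simp add: mult.commute)
  also have "\<dots> = (\<Sum>v\<in>V. card {w \<in> W. \<not> E v w}) + 2 * (\<Sum>v\<in>V. card {w \<in> K. \<not> E v w})"
    by (simp add: sum.distrib sum_distrib_left)
  also have "\<dots> \<le> card W * m + 2 * (card K * m)"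
    unfolding swap[OF WV] swap[OF K_sub(2)] using le[OF WV] le[OF K_sub(2)] by linarith
  also have "\<dots> = (card W + 2 * card K) * m" by (simp add: algebra_simps)
  also have "\<dots> \<le> (3 * r - 1) * m"
    using cardW K_small by (intro mult_right_mono) auto
  finally show False using m by simp
qed

text \<open>Adding edges as long as no clique of size \<open>r + 1\<close> arises preserves the
  degree bound, so the graph may be taken maximal. Non-adjacency is then an equivalence relation.
  Representatives of its classes form a clique, so there are at most \<open>r\<close> classes, and
  these are the colours.\<close>

lemma andrasfai_erdos_sos:
  fixes E :: "'b \<Rightarrow> 'b \<Rightarrow> bool"
  assumes fin: "finite V" and sym: "symp E" and irr: "irreflp E"
    and cl: "\<And>K. K \<subseteq> V \<Longrightarrow> pairwise E K \<Longrightarrow> card K \<le> r"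
    and deg: "\<And>v. v \<in> V \<Longrightarrow> card {u \<in> V. \<not> E v u} \<le> m" and m: "(3 * r - 1) * m < 3 * card V"
  shows "\<exists>c. c ` V \<subseteq> {..<r} \<and> (\<forall>u\<in>V. \<forall>v\<in>V. E u v \<longrightarrow> c u \<noteq> c v)"
proof -
  define good where "good P \<longleftrightarrow> sym P \<and> irrefl P \<and> (\<forall>K\<subseteq>V. pairwise (\<lambda>u v. (u, v) \<in> P) K \<longrightarrow> card K \<le> r)" for P
  define P0 where "P0 = {(u, v). u \<in> V \<and> v \<in> V \<and> E u v}"
  have "good P0"
  proof -
    have "sym P0" "irrefl P0" using sym irr unfolding P0_def sym_def irrefl_def
      by (auto dest: sympD irreflpD)
    moreover have "card K \<le> r" if "K \<subseteq> V" "pairwise (\<lambda>u v. (u, v) \<in> P0) K" for K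
      using cl[of K] that unfolding pairwise_def P0_def by blast
    ultimately show ?thesis unfolding good_def by blast
  qed
  moreover have "finite {P. P \<subseteq> V \<times> V \<and> good P}" using fin by simp
  moreover have "P0 \<subseteq> V \<times> V" unfolding P0_def by auto
  ultimately obtain P where P: "P \<subseteq> V \<times> V" "good P" "P0 \<subseteq> P"
    and Pmax: "\<And>Q. Q \<subseteq> V \<times> V \<Longrightarrow> good Q \<Longrightarrow> P \<subseteq> Q \<Longrightarrow> P = Q"
    using finite_has_maximal2[of "{P. P \<subseteq> V \<times> V \<and> good P}" P0] by auto
  define F where "F u v \<longleftrightarrow> (u, v) \<in> P" for u v
  have F_sym: "symp F" and F_irr: "irreflp F"
    and Fcl: "\<And>K. K \<subseteq> V \<Longrightarrow> pairwise F K \<Longrightarrow> card K \<le> r"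
    using P(2) unfolding good_def F_def sym_def irrefl_def
    by (auto intro!: sympI irreflpI simp: F_def[abs_def])
  have EF: "F u v" if "u \<in> V" "v \<in> V" "E u v" for u v using that P(3) unfolding F_def P0_def by auto
  have Fdeg: "card {u \<in> V. \<not> F v u} \<le> m" if "v \<in> V" for v
  proof -
    have "card {u \<in> V. \<not> F v u} \<le> card {u \<in> V. \<not> E v u}" using EF that fin by (intro card_mono) auto
    then show ?thesis using deg[OF that] by linarith
  qed
  have Fmax: "\<exists>A \<subseteq> V. Suc (card A) = r \<and> pairwise F A \<and> (\<forall>a\<in>A. F x a \<and> F y a)"
    if xy: "x \<in> V" "y \<in> V" "x \<noteq> y" "\<not> F x y" for x y
  proof -
    define Q where "Q = P \<union> {(x, y), (y, x)}"
    have "P \<noteq> Q" using xy unfolding Q_def F_def by auto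
    then have "\<not> good Q" using Pmax[of Q] P(1) xy unfolding Q_def by auto
    moreover have "sym Q" "irrefl Q" using P(2) xy unfolding good_def Q_def sym_def irrefl_def by auto
    ultimately obtain K where K: "K \<subseteq> V" "pairwise (\<lambda>u v. (u, v) \<in> Q) K" "card K > r"
      unfolding good_def by (auto simp: not_le)
    have fK: "finite K" using K(1) fin finite_subset by blast
    have KF: "F u v" if "u \<in> K" "v \<in> K" "u \<noteq> v" "{u, v} \<noteq> {x, y}" for u v
      using K(2) that unfolding pairwise_def Q_def F_def by auto
    have xyK: "x \<in> K" "y \<in> K"
    proof -
      have "\<not> pairwise F K" using Fcl[OF K(1)] K(3) by auto
      then obtain u v where "u \<in> K" "v \<in> K" "{u, v} = {x, y}"
        unfolding pairwise_def using KF by blast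
      then show "x \<in> K" "y \<in> K" by (auto simp: doubleton_eq_iff)
    qed
    \<comment> \<open>Dropping \<open>x\<close> removes the only new edge, so \<open>K - {x}\<close>
      is a clique of the old graph. This caps \<open>card K\<close> at \<open>r + 1\<close>, and
      \<open>K - {x, y}\<close> has exactly \<open>r - 1\<close> elements.\<close>
    have "pairwise F (K - {x})" unfolding pairwise_def using KF by (auto simp: doubleton_eq_iff)
    then have "card (K - {x}) \<le> r" using Fcl[of "K - {x}"] K(1) by blast
    moreover have "Suc (card (K - {x})) = card K" using fK xyK(1) by (rule card_Suc_Diff1)
    ultimately have cK: "card K = Suc r" using K(3) by simp
    have "card (K - {x, y}) = card K - 2"
      using card_Diff_subset[of "{x,y}" K] xyK xy by simp
    moreover have "card K \<ge> 2" using card_mono[OF fK, of "{x,y}"] xyK xy by simp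
    ultimately have "Suc (card (K - {x, y})) = r" using cK by simp
    moreover have "pairwise F (K - {x, y})" unfolding pairwise_def using KF by (auto simp: doubleton_eq_iff)
    moreover have "\<forall>a\<in>K - {x, y}. F x a \<and> F y a" using KF xyK by (auto simp: doubleton_eq_iff)
    ultimately show ?thesis using K(1) by blast
  qed
  have tr: "\<not> F x1 x2" if "x1 \<in> V" "x2 \<in> V" "y \<in> V" "\<not> F y x1" "\<not> F y x2" for x1 x2 y
    using brandt_transitive[OF fin F_sym F_irr Fcl Fmax Fdeg m that] .
  define R where "R = {(u, v). u \<in> V \<and> v \<in> V \<and> \<not> F u v}"
  have eq: "equiv V R"
  proof (rule equivI)
    show "R \<subseteq> V \<times> V" unfolding R_def by auto
    show "refl_on V R" using F_irr unfolding R_def refl_on_def by (auto dest: irreflpD)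
    show "sym R" using F_sym unfolding R_def sym_def by (auto dest: sympD)
    show "trans R" unfolding R_def trans_def using tr F_sym by (auto dest: sympD)
  qed
  define rep where "rep X = (SOME v. v \<in> X)" for X :: "'b set"
  have rep: "rep X \<in> X" "rep X \<in> V" "R `` {rep X} = X" if "X \<in> V // R" for X
  proof -
    have "X \<noteq> {}" using that eq in_quotient_imp_non_empty by blast
    then show *: "rep X \<in> X" unfolding rep_def by (simp add: some_in_eq)
    show "rep X \<in> V" using * that eq in_quotient_imp_subset by blast
    show "R `` {rep X} = X" using * that eq
      by (metis Image_singleton_iff equiv_class_eq_iff quotientE)
  qed
  have inj: "inj_on rep (V // R)" using rep(3) by (metis inj_onI)
  have "pairwise F (rep ` (V // R))"
  proof (unfold pairwise_def, intro ballI impI)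
    fix u v assume "u \<in> rep ` (V // R)" "v \<in> rep ` (V // R)" "u \<noteq> v"
    then obtain X Y where XY: "X \<in> V // R" "Y \<in> V // R" "u = rep X" "v = rep Y" "X \<noteq> Y" by auto
    then have "(u, v) \<notin> R" using rep(3) eq by (metis equiv_class_eq)
    then show "F u v" using XY rep(2) unfolding R_def by auto
  qed
  then have "card (rep ` (V // R)) \<le> r" using Fcl rep(2) by blast
  then have le: "card (V // R) \<le> r" using card_image[OF inj] by simp
  have "finite (V // R)" using fin eq finite_quotient equiv_type by metis
  then obtain h where h: "bij_betw h (V // R) {0..<card (V // R)}" using ex_bij_betw_finite_nat by blast
  define c where "c v = h (R `` {v})" for v
  have cR: "R `` {v} \<in> V // R" if "v \<in> V" for v using that by (rule quotientI)
  have "c v < r" if "v \<in> V" for v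
    using bij_betwE[OF h] cR[OF that] le unfolding c_def by fastforce
  then have "c ` V \<subseteq> {..<r}" by auto
  moreover have "c u \<noteq> c v" if "u \<in> V" "v \<in> V" "E u v" for u v
  proof
    assume "c u = c v"
    then have "R `` {u} = R `` {v}" using h cR that unfolding c_def bij_betw_def inj_on_def by blast
    then have "(u, v) \<in> R" using eq that by (simp add: eq_equiv_class_iff)
    then show False using EF that unfolding R_def by auto
  qed
  ultimately show ?thesis by blast
qed


section \<open>Rigidity of colourings under the degree condition\<close>

text \<open>A colour class lies among the non-neighbours of any of its members, so it has at most
  \<open>m\<close> elements. The set \<open>I\<close> collects the one or two colours whose classes
  must make up for the rest.\<close>

lemma card_le_colour_classes:
  fixes E :: "'b \<Rightarrow> 'b \<Rightarrow> bool"
  assumes fin: "finite V" "finite C" and col: "\<phi> ` V \<subseteq> C"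
    and proper: "\<And>u v. u \<in> V \<Longrightarrow> v \<in> V \<Longrightarrow> E u v \<Longrightarrow> \<phi> u \<noteq> \<phi> v"
    and deg: "\<And>v. v \<in> V \<Longrightarrow> card {u \<in> V. \<not> E v u} \<le> m"
  shows "card V \<le> card {v \<in> V. \<phi> v \<in> I} + card (C - I) * m"
proof -
  have "card V \<le> card ({v \<in> V. \<phi> v \<in> I} \<union> (\<Union>i\<in>C - I. {v \<in> V. \<phi> v = i}))"
    using col fin by (intro card_mono) auto
  also have "\<dots> \<le> card {v \<in> V. \<phi> v \<in> I} + card (\<Union>i\<in>C - I. {v \<in> V. \<phi> v = i})"
    by (rule card_Un_le)
  also have "card (\<Union>i\<in>C - I. {v \<in> V. \<phi> v = i}) \<le> (\<Sum>i\<in>C - I. card {v \<in> V. \<phi> v = i})"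
    using fin by (intro card_UN_le) auto
  also have "(\<Sum>i\<in>C - I. card {v \<in> V. \<phi> v = i}) \<le> card (C - I) * m"
  proof -
    have "card {v \<in> V. \<phi> v = i} \<le> m" for i
    proof (cases "{v \<in> V. \<phi> v = i} = {}")
      case False
      then obtain w where w: "w \<in> V" "\<phi> w = i" by auto
      have "\<not> E w v" if "v \<in> V" "\<phi> v = i" for v
        using proper[OF w(1) that(1)] that(2) w(2) by auto
      then have "card {v \<in> V. \<phi> v = i} \<le> card {u \<in> V. \<not> E w u}"
        using fin by (intro card_mono) auto
      then show ?thesis using deg[OF w(1)] by linarith
    next
      case True
      then show ?thesis by (simp only: card.empty)
    qed
    then show ?thesis using sum_bounded_above[of "C - I" "\<lambda>i. card {v \<in> V. \<phi> v = i}" m] by simp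
  qed
  finally show ?thesis by simp
qed

text \<open>Two vertices of the same colour have a common neighbour \<open>w\<close>, and the neighbourhood of \<open>w\<close>
  satisfies the hypotheses with one colour less and the same \<open>m\<close>.\<close>

lemma colouring_unique:
  fixes E :: "'b \<Rightarrow> 'b \<Rightarrow> bool"
  assumes "finite V" "symp E" "finite C" "card C = r" "finite C'" "card C' = r"
    and "\<phi> ` V \<subseteq> C" "\<And>u v. u \<in> V \<Longrightarrow> v \<in> V \<Longrightarrow> E u v \<Longrightarrow> \<phi> u \<noteq> \<phi> v"
    and "\<psi> ` V \<subseteq> C'" "\<And>u v. u \<in> V \<Longrightarrow> v \<in> V \<Longrightarrow> E u v \<Longrightarrow> \<psi> u \<noteq> \<psi> v"
    and "\<And>v. v \<in> V \<Longrightarrow> card {u \<in> V. \<not> E v u} \<le> m" "(3 * r - 1) * m < 3 * card V"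
    and "u \<in> V" "v \<in> V" "\<phi> u = \<phi> v"
  shows "\<psi> u = \<psi> v"
  using assms
proof (induction r arbitrary: V C C')
  case 0
  then show ?case by auto
next
  case (Suc r)
  note fin = \<open>finite V\<close> and E_sym = sympD[OF \<open>symp E\<close>]
  note proper = Suc.prems(8) and proper' = Suc.prems(10) and deg = Suc.prems(11)
  note uv = \<open>u \<in> V\<close> \<open>v \<in> V\<close> \<open>\<phi> u = \<phi> v\<close>
  show ?case
  proof (cases "r = 0")
    case True
    then obtain a where "C' = {a}" using \<open>card C' = Suc r\<close> by (metis One_nat_def card_1_singletonE)
    then show ?thesis using uv \<open>\<psi> ` V \<subseteq> C'\<close> by auto
  next
    case False
    have m: "(3 * r + 2) * m < 3 * card V" using Suc.prems(12) by simp
    define N where "N w = {z \<in> V. \<not> E w z}" for w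
    have fN: "finite (N w)" for w unfolding N_def using fin by simp
    have "card (C - {\<phi> u}) = r"
      using Suc.prems(3,4,7) uv by (simp add: image_subset_iff)
    then have 1: "card V \<le> card {z \<in> V. \<phi> z = \<phi> u} + r * m"
      using card_le_colour_classes[of V C \<phi> E m "{\<phi> u}", OF fin \<open>finite C\<close> \<open>\<phi> ` V \<subseteq> C\<close> proper deg] by simp
    \<comment> \<open>With \<open>r + 1\<close> colours, the common class of \<open>u\<close> and
      \<open>v\<close> has at least \<open>card V - r * m\<close> elements. It lies in both
      non-neighbourhoods, so these overlap too much to cover \<open>V\<close>.\<close>
    have "{z \<in> V. \<phi> z = \<phi> u} \<subseteq> N u \<inter> N v"
    proof
      fix z assume z: "z \<in> {z \<in> V. \<phi> z = \<phi> u}"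
      then have "\<not> E u z" "\<not> E v z" using proper[of u z] proper[of v z] uv by auto
      then show "z \<in> N u \<inter> N v" using z unfolding N_def by simp
    qed
    then have "card {z \<in> V. \<phi> z = \<phi> u} \<le> card (N u \<inter> N v)"
      using fN by (intro card_mono) auto
    then have "card (N u \<union> N v) + card V \<le> (r + 2) * m"
      using 1 card_Un_Int[OF fN fN, of u v] deg[OF uv(1)] deg[OF uv(2)] unfolding N_def by simp
    \<comment> \<open>This amounts to \<open>2 \<le> 3 * r\<close>, the reason for treating a single
      colour separately.\<close>
    moreover have "3 * ((r + 2) * m) \<le> 2 * ((3 * r + 2) * m)"
      using mult_right_mono[of "3 * (r + 2)" "2 * (3 * r + 2)" m] False by (simp add: algebra_simps)
    ultimately have "card (N u \<union> N v) < card V" using m by linarith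
    then have "\<not> V \<subseteq> N u \<union> N v" using card_mono[of "N u \<union> N v" V] fN by auto
    then obtain w where w: "w \<in> V" "E u w" "E v w" unfolding N_def by blast
    define V' where "V' = {z \<in> V. E w z}"
    have V'V: "V' \<subseteq> V" unfolding V'_def by auto
    have "card V = card V' + card (N w)"
      unfolding V'_def N_def using fin by (subst card_Un_disjoint[symmetric]) (auto intro: arg_cong[where f = card])
    then have cV': "card V \<le> card V' + m" using deg[OF w(1)] unfolding N_def by simp
    show ?thesis
    proof (rule Suc.IH[of V' "C - {\<phi> w}" "C' - {\<psi> w}"])
      show "\<phi> ` V' \<subseteq> C - {\<phi> w}" "\<psi> ` V' \<subseteq> C' - {\<psi> w}"
        using Suc.prems(7,9) proper[OF w(1)] proper'[OF w(1)] unfolding V'_def by fastforce+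
      show "card (C - {\<phi> w}) = r" "card (C' - {\<psi> w}) = r"
        using Suc.prems(3-7,9) w by (simp_all add: image_subset_iff)
      show "card {z \<in> V'. \<not> E y z} \<le> m" if "y \<in> V'" for y
      proof -
        have "card {z \<in> V'. \<not> E y z} \<le> card {z \<in> V. \<not> E y z}"
          using fin V'V by (intro card_mono) auto
        then show ?thesis using deg[of y] that V'V by force
      qed
      show "(3 * r - 1) * m < 3 * card V'"
      proof -
        have "(3 * r - 1) * m + 3 * m = (3 * r + 2) * m" using False
          by (cases r) (simp_all add: algebra_simps)
        then show ?thesis using m cV' by linarith
      qed
      show "u \<in> V'" "v \<in> V'" using uv w E_sym unfolding V'_def by blast+
      show "\<phi> y \<noteq> \<phi> z" "\<psi> y \<noteq> \<psi> z" if "y \<in> V'" "z \<in> V'" "E y z" for y z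
        using proper[of y z] proper'[of y z] that V'V by blast+
      show "finite V'" using fin V'V finite_subset by blast
    qed (use Suc.prems in simp_all)
  qed
qed

text \<open>\<open>N\<close> stands for adjacency to a further vertex. If two colours were absent
  from \<open>N\<close>, both classes would lie in its complement of at most \<open>m\<close>
  elements, leaving at most \<open>(r - 1) * m\<close> vertices in all. So an absent colour is
  determined, and it can serve as the colour of the further vertex.\<close>

lemma missing_colour_unique:
  fixes E :: "'b \<Rightarrow> 'b \<Rightarrow> bool"
  assumes fin: "finite V" "finite C" "card C = r" and col: "\<phi> ` V \<subseteq> C"
    and proper: "\<And>u v. u \<in> V \<Longrightarrow> v \<in> V \<Longrightarrow> E u v \<Longrightarrow> \<phi> u \<noteq> \<phi> v"
    and deg: "\<And>v. v \<in> V \<Longrightarrow> card {u \<in> V. \<not> E v u} \<le> m" and m: "(3 * r - 1) * m < 3 * card V"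
    and N: "card {u \<in> V. \<not> N u} \<le> m"
    and ij: "i \<in> C" "j \<in> C" "\<And>u. u \<in> V \<Longrightarrow> N u \<Longrightarrow> \<phi> u \<noteq> i" "\<And>u. u \<in> V \<Longrightarrow> N u \<Longrightarrow> \<phi> u \<noteq> j"
  shows "i = j"
proof (rule ccontr)
  assume "i \<noteq> j"
  then have C: "card (C - {i, j}) = r - 2" "r \<ge> 2"
    using fin ij card_Diff_subset[of "{i,j}" C] card_mono[of C "{i,j}"] by auto
  have "card {v \<in> V. \<phi> v \<in> {i, j}} \<le> card {u \<in> V. \<not> N u}"
    using ij fin by (intro card_mono) auto
  then have "card V \<le> m + (r - 2) * m"
    using card_le_colour_classes[of V C \<phi> E m "{i, j}", OF fin(1,2) col proper deg] C N by simp
  also have "\<dots> = (r - 1) * m" using C(2) by (cases r) (auto simp: algebra_simps Suc_diff_Suc mult_eq_if)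
  finally have "3 * card V \<le> (3 * (r - 1)) * m" by simp
  also have "\<dots> \<le> (3 * r - 1) * m" by (intro mult_right_mono) auto
  finally show False using m by simp
qed

section \<open>Random tuples\<close>

text \<open>Sampling with replacement: entries may repeat, so that sums over tuples factor and
  probabilities are proportions of \<open>card V ^ k\<close>.\<close>

definition tuples :: "'b set \<Rightarrow> nat \<Rightarrow> 'b list set" where
  "tuples V k = {xs. set xs \<subseteq> V \<and> length xs = k}"

lemma finite_tuples: "finite V \<Longrightarrow> finite (tuples V k)"
  unfolding tuples_def by (rule finite_lists_length_eq)

lemma card_tuples: "finite V \<Longrightarrow> card (tuples V k) = card V ^ k"
  unfolding tuples_def by (rule card_lists_length_eq)

lemma tuples_0: "tuples V 0 = {[]}"
  unfolding tuples_def by auto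

lemma sum_tuples_Suc:
  "(\<Sum>xs\<in>tuples V (Suc k). F xs) = (\<Sum>v\<in>V. \<Sum>ys\<in>tuples V k. F (v # ys))"
proof -
  have "bij_betw (\<lambda>(v, ys). v # ys) (V \<times> tuples V k) (tuples V (Suc k))"
    unfolding bij_betw_def inj_on_def tuples_def
    by (auto simp: image_iff length_Suc_conv)
  then have "(\<Sum>xs\<in>tuples V (Suc k). F xs) = (\<Sum>(v, ys)\<in>V \<times> tuples V k. F (v # ys))"
    by (simp add: sum.reindex_bij_betw[symmetric] case_prod_unfold)
  then show ?thesis by (simp add: sum.cartesian_product)
qed

lemma card_tuples_Suc:
  assumes "finite V"
  shows "card {xs \<in> tuples V (Suc k). P xs} = (\<Sum>v\<in>V. card {ys \<in> tuples V k. P (v # ys)})"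
proof -
  have "card {xs \<in> tuples V l. Q xs} = (\<Sum>xs\<in>tuples V l. if Q xs then 1 else 0)" for l Q
    using finite_tuples[OF assms, of l] by (simp add: sum.If_cases Int_def)
  then show ?thesis by (simp add: sum_tuples_Suc)
qed

text \<open>Independence of the entries. The factor depends on the position \<open>j\<close>, so
  that one entry can be pinned to a vertex while the others are averaged.\<close>

lemma sum_prod_tuples:
  fixes f :: "nat \<Rightarrow> 'b \<Rightarrow> real"
  shows "(\<Sum>xs\<in>tuples V k. \<Prod>j<k. f j (xs ! j)) = (\<Prod>j<k. \<Sum>v\<in>V. f j v)"
proof (induction k arbitrary: f)
  case 0
  then show ?case by (simp add: tuples_0)
next
  case (Suc k)
  have "(\<Sum>xs\<in>tuples V (Suc k). \<Prod>j<Suc k. f j (xs ! j))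
      = (\<Sum>v\<in>V. \<Sum>ys\<in>tuples V k. f 0 v * (\<Prod>j<k. f (Suc j) (ys ! j)))"
    unfolding sum_tuples_Suc by (simp only: prod.lessThan_Suc_shift) simp
  also have "\<dots> = (\<Sum>v\<in>V. f 0 v) * (\<Sum>ys\<in>tuples V k. \<Prod>j<k. f (Suc j) (ys ! j))"
    by (simp only: sum_product)
  also have "\<dots> = (\<Prod>j<Suc k. \<Sum>v\<in>V. f j v)"
    unfolding prod.lessThan_Suc_shift using Suc.IH[of "\<lambda>j. f (Suc j)"] by simp
  finally show ?case .
qed

text \<open>Chernoff's bound for a random tuple. The \<open>i\<close>-th entry is not independent of itself, which
  costs the additional summand \<open>\<beta>\<close> in the exponent.\<close>

lemma few_tuples_with_many_related_entries:
  fixes p \<tau> \<beta> :: real and N :: "'b \<Rightarrow> 'b \<Rightarrow> bool"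
  assumes fin: "finite V" and i: "i < M" and \<beta>: "0 \<le> \<beta>" "\<beta> \<le> 1" and p0: "0 \<le> p"
    and p: "\<And>v. v \<in> V \<Longrightarrow> card {u \<in> V. N v u} \<le> p * card V"
  shows "card {xs \<in> tuples V M. \<tau> \<le> card {j. j < M \<and> N (xs ! i) (xs ! j)}}
    \<le> exp (\<beta> + p * (\<beta> + \<beta>\<^sup>2) * M - \<beta> * \<tau>) * card V ^ M" (is "real (card ?B) \<le> _")
proof -
  \<comment> \<open>The \<open>i\<close>-th factor pins entry \<open>i\<close> to \<open>v\<close>,
    with weight \<open>exp \<beta>\<close> whether or not \<open>N v v\<close> holds. After summing
    over \<open>v\<close> outside, the other factors no longer depend on entry
    \<open>i\<close>.\<close>
  define f where "f v j y = (if j = i then (if y = v then exp \<beta> else 0) else if N v y then exp \<beta> else 1)" for v j y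
  have f0: "0 \<le> f v j y" for v j y unfolding f_def by auto
  define q where "q = p * (\<beta> + \<beta>\<^sup>2)"
  have q0: "0 \<le> q" unfolding q_def using p0 \<beta> by simp
  have "exp (\<beta> * \<tau>) * card ?B = (\<Sum>xs\<in>?B. exp (\<beta> * \<tau>))" by simp
  also have "\<dots> \<le> (\<Sum>xs\<in>?B. \<Sum>v\<in>V. \<Prod>j<M. f v j (xs ! j))"
  proof (rule sum_mono)
    fix xs assume xs: "xs \<in> ?B"
    define v where "v = xs ! i"
    have v: "v \<in> V" using xs i unfolding v_def tuples_def by auto
    have "exp (\<beta> * \<tau>) \<le> exp (\<beta> * card {j. j < M \<and> N v (xs ! j)})"
      using xs \<beta> unfolding v_def by (auto intro: mult_left_mono)
    also have "\<dots> = exp (\<Sum>j<M. if N v (xs ! j) then \<beta> else 0)"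
      by (simp add: sum.If_cases Int_def mult.commute)
    also have "\<dots> = (\<Prod>j<M. exp (if N v (xs ! j) then \<beta> else 0))"
      by (simp add: exp_sum)
    also have "\<dots> \<le> (\<Prod>j<M. f v j (xs ! j))"
      using \<beta> by (intro prod_mono) (auto simp: f_def v_def)
    also have "\<dots> \<le> (\<Sum>v\<in>V. \<Prod>j<M. f v j (xs ! j))"
      using v fin f0 by (intro member_le_sum prod_nonneg) auto
    finally show "exp (\<beta> * \<tau>) \<le> (\<Sum>v\<in>V. \<Prod>j<M. f v j (xs ! j))" .
  qed
  also have "\<dots> \<le> (\<Sum>xs\<in>tuples V M. \<Sum>v\<in>V. \<Prod>j<M. f v j (xs ! j))"
    using finite_tuples[OF fin] f0 by (intro sum_mono2 sum_nonneg prod_nonneg) auto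
  also have "\<dots> = (\<Sum>v\<in>V. \<Prod>j<M. \<Sum>y\<in>V. f v j y)"
    by (subst sum.swap) (simp add: sum_prod_tuples)
  also have "\<dots> \<le> (\<Sum>v\<in>V. exp \<beta> * (card V * exp q) ^ (M - 1))"
  proof (rule sum_mono)
    fix v assume v: "v \<in> V"
    have "(\<Prod>j<M. \<Sum>y\<in>V. f v j y) \<le> (\<Prod>j<M. if j = i then exp \<beta> else card V * exp q)"
    proof (rule prod_mono, rule conjI)
      fix j
      show "0 \<le> (\<Sum>y\<in>V. f v j y)" using f0 by (intro sum_nonneg) auto
      show "(\<Sum>y\<in>V. f v j y) \<le> (if j = i then exp \<beta> else card V * exp q)"
      proof (cases "j = i")
        case True
        then show ?thesis using fin v unfolding f_def by simp
      next
        case False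
        have "(\<Sum>y\<in>V. f v j y) = (\<Sum>y\<in>V. 1 + (if N v y then exp \<beta> - 1 else 0))"
          unfolding f_def using False by (intro sum.cong) auto
        also have "\<dots> = card V + card {u \<in> V. N v u} * (exp \<beta> - 1)"
          using fin by (simp add: sum.distrib sum.If_cases Int_def)
        also have "\<dots> \<le> card V + (p * card V) * (\<beta> + \<beta>\<^sup>2)"
          using p[OF v] exp_bound[OF \<beta>] \<beta> by (intro add_left_mono mult_mono) auto
        also have "\<dots> = card V * (1 + q)" unfolding q_def by (simp add: algebra_simps)
        also have "\<dots> \<le> card V * exp q" by (intro mult_left_mono exp_ge_add_one_self) auto
        finally show ?thesis using False by simp
      qed
    qed
    also have "\<dots> = exp \<beta> * (card V * exp q) ^ (M - 1)"
    proof -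
      have "(\<Prod>j<M. if j = i then exp \<beta> else card V * exp q)
        = exp \<beta> * (\<Prod>j\<in>{..<M} - {i}. if j = i then exp \<beta> else card V * exp q)"
        using i by (subst prod.remove[of _ i]) auto
      also have "(\<Prod>j\<in>{..<M} - {i}. if j = i then exp \<beta> else card V * exp q)
        = (\<Prod>j\<in>{..<M} - {i}. card V * exp q)" by (intro prod.cong) auto
      finally show ?thesis using i by simp
    qed
    finally show "(\<Prod>j<M. \<Sum>y\<in>V. f v j y) \<le> exp \<beta> * (card V * exp q) ^ (M - 1)" .
  qed
  also have "\<dots> = exp (\<beta> + q * (real M - 1)) * card V ^ M"
    using i by (cases M) (simp_all add: power_mult_distrib exp_add exp_of_nat_mult[symmetric] mult.commute)
  also have "\<dots> \<le> exp (\<beta> + q * M) * card V ^ M"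
    using q0 by (intro mult_right_mono) (auto simp: algebra_simps)
  finally have "card ?B \<le> exp (\<beta> + q * M) * card V ^ M / exp (\<beta> * \<tau>)"
    by (simp add: pos_le_divide_eq mult.commute)
  then show ?thesis by (simp add: exp_diff q_def)
qed

text \<open>Erdos' theorem on complete partite hypergraphs. Constantly many vertices \<open>W\<close> that are each first
  entry of a positive proportion of tuples suffice to find, by pigeonhole, \<open>t\<close> of them which share a
  positive proportion of tails.\<close>

lemma box_in_dense_relation:
  fixes \<gamma> :: real
  assumes "0 < \<gamma>"
  shows "\<exists>n\<^sub>0. \<forall>(V :: 'b set) R. finite V \<longrightarrow> n\<^sub>0 \<le> card V \<longrightarrow> R \<subseteq> tuples V k \<longrightarrow>
    \<gamma> * card V ^ k \<le> card R \<longrightarrow>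
    (\<exists>As. length As = k \<and> (\<forall>A\<in>set As. A \<subseteq> V \<and> card A = t) \<and> listset As \<subseteq> R)"
  using assms
proof (induction k arbitrary: \<gamma>)
  case 0
  have "listset [] \<subseteq> R" if "R \<subseteq> tuples V 0" "\<gamma> * card V ^ 0 \<le> card R" for V :: "'b set" and R
    using that \<open>0 < \<gamma>\<close> by (auto simp: tuples_0 subset_singleton_iff)
  then show ?case by (intro exI[of _ 0]) auto
next
  case (Suc k)
  \<comment> \<open>A set \<open>W\<close> of \<open>M\<close> vertices will meet an average tail in
    at least \<open>\<gamma> / 2 * M\<close> elements; discounting
    \<open>t \<le> \<gamma> / 4 * M\<close> per tail leaves \<open>\<gamma> / 4 * M\<close>. The
    factor \<open>2 ^ M\<close> in \<open>\<gamma>'\<close> bounds the number of candidate sets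
    \<open>T\<close>.\<close>
  define M where "M = Suc (nat \<lceil>4 * t / \<gamma>\<rceil>)"
  have M: "4 * t \<le> \<gamma> * M" "0 < M"
  proof -
    have "4 * t / \<gamma> \<le> M" unfolding M_def by linarith
    then show "4 * t \<le> \<gamma> * M" using \<open>0 < \<gamma>\<close> by (simp add: field_simps)
  qed (simp add: M_def)
  define \<gamma>' where "\<gamma>' = \<gamma> / (4 * 2 ^ M)"
  have "0 < \<gamma>'" using Suc.prems unfolding \<gamma>'_def by simp
  from Suc.IH[OF this] obtain n\<^sub>0 where n0: "\<And>(V :: 'b set) R. finite V \<Longrightarrow> n\<^sub>0 \<le> card V \<Longrightarrow> R \<subseteq> tuples V k \<Longrightarrow>
    \<gamma>' * card V ^ k \<le> card R \<Longrightarrow>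
    (\<exists>As. length As = k \<and> (\<forall>A\<in>set As. A \<subseteq> V \<and> card A = t) \<and> listset As \<subseteq> R)" by blast
  define n\<^sub>1 where "n\<^sub>1 = max n\<^sub>0 (Suc (nat \<lceil>2 * M / \<gamma>\<rceil>))"
  have "\<exists>As. length As = Suc k \<and> (\<forall>A\<in>set As. A \<subseteq> V \<and> card A = t) \<and> listset As \<subseteq> R"
    if fin: "finite V" and n: "n\<^sub>1 \<le> card V" and R: "R \<subseteq> tuples V (Suc k)" and dense: "\<gamma> * card V ^ Suc k \<le> card R"
    for V :: "'b set" and R
  proof -
    define L :: real where "L = card V ^ k"
    have "2 * M / \<gamma> \<le> card V" "0 < card V" "n\<^sub>0 \<le> card V" using n unfolding n\<^sub>1_def by linarith+
    then have nM: "M \<le> \<gamma> / 2 * card V" and L0: "0 < L" using \<open>0 < \<gamma>\<close>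
      by (auto simp: field_simps L_def card_gt_0_iff)
    define Y where "Y = tuples V k"
    have Y: "finite Y" "card Y = L" unfolding Y_def L_def using fin by (simp_all add: finite_tuples card_tuples)
    define e where "e v = card {ys \<in> Y. v # ys \<in> R}" for v
    have e_le: "e v \<le> L" for v unfolding e_def Y(2)[symmetric] using Y(1) by (auto intro: card_mono)
    have "R = {xs \<in> tuples V (Suc k). xs \<in> R}" using R by auto
    then have cR: "card R = (\<Sum>v\<in>V. e v)"
      unfolding e_def Y_def using card_tuples_Suc[OF fin, of k "\<lambda>xs. xs \<in> R"] by simp
    define V' where "V' = {v \<in> V. \<gamma> / 2 * L \<le> e v}"
    have "\<gamma> * L * card V \<le> card R" using dense by (simp add: L_def algebra_simps)
    also have "\<dots> = (\<Sum>v\<in>V. real (e v))" unfolding cR by simp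
    also have "\<dots> \<le> (\<Sum>v\<in>V. (if \<gamma> / 2 * L \<le> e v then L else 0) + \<gamma> / 2 * L)"
      using e_le \<open>0 < \<gamma>\<close> L0 by (intro sum_mono) (auto simp: add_increasing2)
    also have "\<dots> = card V' * L + \<gamma> / 2 * L * card V"
      using fin by (simp add: sum.distrib sum.If_cases V'_def Int_def)
    finally have "\<gamma> / 2 * card V * L \<le> card V' * L" by (simp add: algebra_simps)
    then have "\<gamma> / 2 * card V \<le> card V'" using L0 by simp
    then have "M \<le> card V'" using nM by linarith
    then obtain W where W: "W \<subseteq> V'" "card W = M" "finite W"
      using obtain_subset_with_card_n by metis
    have WV: "W \<subseteq> V" using W unfolding V'_def by auto
    define d where "d ys = card {w \<in> W. w # ys \<in> R}" for ys
    have d_le: "d ys \<le> M" for ys unfolding d_def W(2)[symmetric] using W(3) by (auto intro: card_mono)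
    define Y' where "Y' = {ys \<in> Y. t \<le> d ys}"
    have "real M * (\<gamma> / 2 * L) \<le> (\<Sum>w\<in>W. real (e w))"
      using sum_bounded_below[of W "\<gamma> / 2 * L" "\<lambda>w. real (e w)"] W unfolding V'_def by auto
    also have "\<dots> = (\<Sum>w\<in>W. \<Sum>ys\<in>Y. if w # ys \<in> R then 1 else 0)"
      unfolding e_def using Y(1) by (simp add: sum.If_cases Int_def)
    also have "\<dots> = (\<Sum>ys\<in>Y. real (d ys))"
      unfolding d_def using W(3) by (subst sum.swap) (simp add: sum.If_cases Int_def)
    also have "\<dots> \<le> (\<Sum>ys\<in>Y. (if t \<le> d ys then real M else 0) + t)"
      using d_le by (intro sum_mono) (auto simp: add_increasing2)
    also have "\<dots> = card Y' * M + L * t"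
      using Y by (simp add: sum.distrib sum.If_cases Y'_def Int_def)
    also have "L * t \<le> L * (\<gamma> * M / 4)" using M L0 by (intro mult_left_mono) auto
    finally have "(\<gamma> / 4 * L) * M \<le> card Y' * M" by (simp add: algebra_simps)
    then have Y': "\<gamma> / 4 * L \<le> card Y'" using M(2) by simp
    define Z where "Z T = {ys \<in> Y. \<forall>w\<in>T. w # ys \<in> R}" for T
    define Ts where "Ts = {T. T \<subseteq> W \<and> card T = t}"
    have Ts: "finite Ts" "card Ts \<le> 2 ^ M"
      using card_mono[of "Pow W" Ts] W by (auto simp: Ts_def card_Pow)
    have "Y' \<subseteq> (\<Union>T\<in>Ts. Z T)"
    proof
      fix ys assume ys: "ys \<in> Y'"
      then obtain T where "T \<subseteq> {w \<in> W. w # ys \<in> R}" "card T = t"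
        unfolding Y'_def d_def by (auto elim: obtain_subset_with_card_n)
      then show "ys \<in> (\<Union>T\<in>Ts. Z T)" using ys unfolding Ts_def Z_def Y'_def by blast
    qed
    then have "card Y' \<le> card (\<Union>T\<in>Ts. Z T)"
      using Ts Y(1) unfolding Z_def by (intro card_mono) auto
    also have "\<dots> \<le> (\<Sum>T\<in>Ts. card (Z T))" using Ts(1) by (rule card_UN_le)
    finally have sumZ: "card Y' \<le> (\<Sum>T\<in>Ts. card (Z T))" .
    have "\<exists>T\<in>Ts. \<gamma>' * L \<le> card (Z T)"
    proof (rule ccontr)
      assume "\<not> ?thesis"
      then have lt: "real (card (Z T)) < \<gamma>' * L" if "T \<in> Ts" for T using that by auto
      have "0 < \<gamma> / 4 * L" using \<open>0 < \<gamma>\<close> L0 by simp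
      then have "Ts \<noteq> {}" using sumZ Y' by auto
      then have "(\<Sum>T\<in>Ts. real (card (Z T))) < card Ts * (\<gamma>' * L)"
        using sum_bounded_above_strict[of Ts "\<lambda>T. real (card (Z T))" "\<gamma>' * L"] lt Ts
        by (simp add: card_gt_0_iff)
      also have "\<dots> \<le> 2 ^ M * (\<gamma>' * L)"
      proof (rule mult_right_mono)
        show "real (card Ts) \<le> 2 ^ M" using Ts(2) of_nat_le_iff[of "card Ts" "2 ^ M", where 'a = real] by simp
      qed (use L0 \<open>0 < \<gamma>'\<close> in simp)
      also have "\<dots> = \<gamma> / 4 * L" unfolding \<gamma>'_def by simp
      finally show False using Y' sumZ by (simp flip: of_nat_sum)
    qed
    then obtain T where T: "T \<in> Ts" "\<gamma>' * L \<le> card (Z T)" by blast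
    have "Z T \<subseteq> tuples V k" unfolding Z_def Y_def by auto
    from n0[OF fin \<open>n\<^sub>0 \<le> card V\<close> this T(2)[unfolded L_def]]
    obtain As where As: "length As = k" "\<forall>A\<in>set As. A \<subseteq> V \<and> card A = t" "listset As \<subseteq> Z T" by auto
    then have "length (T # As) = Suc k \<and> (\<forall>A\<in>set (T # As). A \<subseteq> V \<and> card A = t) \<and> listset (T # As) \<subseteq> R"
      using T(1) WV unfolding Ts_def Z_def by (auto simp: set_Cons_def)
    then show ?thesis by blast
  qed
  then show ?case by blast
qed

section \<open>The upper bound\<close>

lemma edge_endpoints:
  assumes "simple_graph G" "{u, v} \<in> edges G"
  shows "u \<in> verts G" "v \<in> verts G" "u \<noteq> v"
proof -
  have "{u, v} \<subseteq> verts G" "card {u, v} = 2"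
    using assms unfolding simple_graph_def nsets_def by auto
  then show "u \<in> verts G" "v \<in> verts G" "u \<noteq> v" by auto
qed

lemma edge_cases:
  assumes "simple_graph G" "e \<in> edges G"
  obtains u v where "e = {u, v}" "u \<noteq> v" "u \<in> verts G" "v \<in> verts G"
proof -
  have "e \<subseteq> verts G" "card e = 2" using assms unfolding simple_graph_def nsets_def by auto
  then show ?thesis using that by (auto simp: card_2_iff)
qed

lemma not_graph_freeI:
  assumes H: "simple_graph H" and inj: "inj_on f (verts H)" and fV: "f ` verts H \<subseteq> verts G"
    and hom: "\<And>u v. {u, v} \<in> edges H \<Longrightarrow> {f u, f v} \<in> edges G"
  shows "\<not> graph_free H G"
proof -
  \<comment> \<open>Only images of edges of \<open>H\<close> are kept: the image may span further
    edges of \<open>G\<close>, which would spoil the isomorphism.\<close>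
  define F where "F = \<lparr>verts = f ` verts H, edges = image f ` edges H\<rparr>"
  have sub: "e \<subseteq> verts H" if "e \<in> edges H" for e
    using that H unfolding simple_graph_def nsets_def by auto
  have "simple_graph F"
    unfolding simple_graph_def
  proof
    show "finite (verts F)" using H by (simp add: F_def simple_graph_def)
    show "edges F \<subseteq> nsets (verts F) 2"
    proof
      fix e' assume "e' \<in> edges F"
      then obtain e where e: "e \<in> edges H" "e' = f ` e" by (auto simp: F_def)
      moreover have "card (f ` e) = card e" using inj sub[OF e(1)] by (meson card_image inj_on_subset)
      ultimately show "e' \<in> nsets (verts F) 2"
        using H sub[OF e(1)] by (auto simp: F_def simple_graph_def nsets_def)
    qed
  qed
  moreover have "edges F \<subseteq> edges G"
  proof
    fix e' assume "e' \<in> edges F"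
    then obtain e where e: "e \<in> edges H" "e' = f ` e" by (auto simp: F_def)
    obtain u v where "e = {u, v}" using edge_cases[OF H e(1)] by metis
    then show "e' \<in> edges G" using hom e by auto
  qed
  ultimately have "subgraph_of F G" using fV by (simp add: subgraph_of_def F_def)
  moreover have "isomorphic H F"
    unfolding isomorphic_def
  proof (intro exI[of _ f] conjI ballI)
    show "bij_betw f (verts H) (verts F)" using inj by (simp add: F_def bij_betw_def)
    fix u v assume uv: "u \<in> verts H" "v \<in> verts H"
    show "{u, v} \<in> edges H \<longleftrightarrow> {f u, f v} \<in> edges F"
    proof
      assume "{u, v} \<in> edges H"
      then have "f ` {u, v} \<in> edges F" unfolding F_def by (simp del: image_insert)
      then show "{f u, f v} \<in> edges F" by simp
    next
      assume "{f u, f v} \<in> edges F"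
      then obtain e where e: "e \<in> edges H" "f ` {u, v} = f ` e" unfolding F_def by auto
      then have "{u, v} = e"
        using inj_on_image_eq_iff[OF inj, of "{u, v}" e] sub[OF e(1)] uv by (simp del: image_insert)
      then show "{u, v} \<in> edges H" using e(1) by simp
    qed
  qed
  ultimately show ?thesis unfolding graph_free_def by blast
qed

lemma in_listset_iff: "xs \<in> listset As \<longleftrightarrow> list_all2 (\<in>) xs As"
  by (induction As arbitrary: xs) (auto simp: set_Cons_def list_all2_Cons2)

text \<open>A positive proportion of such tuples would contain a box whose \<open>q\<close> sides
  indexed by \<open>J\<close> are completely joined to each other, and placing the colour classes of
  \<open>H\<close> in these sides gives a copy of \<open>H\<close>. Tuples keep all \<open>M\<close>
  entries although only those in \<open>J\<close> are constrained, so one \<open>n\<^sub>0\<close>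
  serves every \<open>J\<close> and bad samples can be counted directly.\<close>

lemma few_clique_tuples:
  fixes H :: "'a graph" and \<gamma> :: real
  assumes H: "simple_graph H" "partite q H" and \<gamma>: "0 < \<gamma>"
  shows "\<exists>n\<^sub>0. \<forall>(G :: 'b graph) J. simple_graph G \<longrightarrow> graph_free H G \<longrightarrow> n\<^sub>0 \<le> card (verts G) \<longrightarrow>
    J \<subseteq> {..<M} \<longrightarrow> card J = q \<longrightarrow>
    card {xs \<in> tuples (verts G) M. pairwise (\<lambda>i j. {xs ! i, xs ! j} \<in> edges G) J} < \<gamma> * card (verts G) ^ M"
proof -
  \<comment> \<open>The \<open>Suc\<close> keeps the sides of the box non-empty, so that entries at
    positions other than \<open>i\<close> and \<open>j\<close> can be filled in.\<close>
  define t where "t = Suc (card (verts H))"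
  obtain n\<^sub>0 where n0: "\<And>(V :: 'b set) R. finite V \<Longrightarrow> n\<^sub>0 \<le> card V \<Longrightarrow> R \<subseteq> tuples V M \<Longrightarrow>
      \<gamma> * card V ^ M \<le> card R \<Longrightarrow>
      \<exists>As. length As = M \<and> (\<forall>A\<in>set As. A \<subseteq> V \<and> card A = t) \<and> listset As \<subseteq> R"
    using box_in_dense_relation[OF \<gamma>, of M t] by blast
  obtain c where c: "c ` verts H \<subseteq> {..<q}" "\<And>u v. {u, v} \<in> edges H \<Longrightarrow> c u \<noteq> c v"
    using H(2) unfolding partite_def by blast
  have "card {xs \<in> tuples (verts G) M. pairwise (\<lambda>i j. {xs ! i, xs ! j} \<in> edges G) J} < \<gamma> * card (verts G) ^ M"
    if G: "simple_graph G" "graph_free H G" "n\<^sub>0 \<le> card (verts G)" and J: "J \<subseteq> {..<M}" "card J = q"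
    for G :: "'b graph" and J
  proof (rule ccontr)
    let ?R = "{xs \<in> tuples (verts G) M. pairwise (\<lambda>i j. {xs ! i, xs ! j} \<in> edges G) J}"
    assume "\<not> ?thesis"
    moreover have finV: "finite (verts G)" using G(1) by (simp add: simple_graph_def)
    ultimately obtain As where As: "length As = M" "\<And>A. A \<in> set As \<Longrightarrow> A \<subseteq> verts G \<and> card A = t" "listset As \<subseteq> ?R"
      using n0[of "verts G" ?R] G(3) by (auto simp: not_less)
    have At: "As ! k \<subseteq> verts G" "card (As ! k) = t" if "k < M" for k
      using As(2)[of "As ! k"] that As(1) by auto
    have An: "finite (As ! k)" "As ! k \<noteq> {}" if "k < M" for k
      using At[OF that] finV finite_subset unfolding t_def by auto
    have adj: "{a, b} \<in> edges G" if ij: "i \<in> J" "j \<in> J" "i \<noteq> j" and ab: "a \<in> As ! i" "b \<in> As ! j" for i j a b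
    proof -
      define xs where "xs = map (\<lambda>k. if k = i then a else if k = j then b else SOME x. x \<in> As ! k) [0..<M]"
      have "xs \<in> listset As"
        using An ab As(1) by (auto simp: in_listset_iff list_all2_conv_all_nth xs_def some_in_eq)
      then have "{xs ! i, xs ! j} \<in> edges G" using As(3) ij unfolding pairwise_def by blast
      then show ?thesis using ij J(1) unfolding xs_def by (auto simp: subset_iff)
    qed
    have "finite J" using J(1) finite_subset by blast
    then obtain \<kappa> where \<kappa>: "bij_betw \<kappa> {..<q} J"
      using ex_bij_betw_nat_finite[of J] J(2) by (auto simp: atLeast0LessThan)
    define col where "col h = \<kappa> (c h)" for h
    have col: "col h \<in> J" "col h < M" if "h \<in> verts H" for h
      using that c(1) \<kappa> J(1) unfolding col_def bij_betw_def by auto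
    have col_ne: "col u \<noteq> col v" if "{u, v} \<in> edges H" for u v
      using c(2)[OF that] edge_endpoints[OF H(1) that] c(1) \<kappa>
      unfolding col_def bij_betw_def inj_on_def by blast
    have "\<exists>e. e ` verts H \<subseteq> As ! k \<and> inj_on e (verts H)" if "k < M" for k
      using card_le_inj[of "verts H" "As ! k"] An(1)[OF that] At(2)[OF that] H(1)
      unfolding t_def simple_graph_def by auto
    then obtain e where e: "\<And>k. k < M \<Longrightarrow> e k ` verts H \<subseteq> As ! k \<and> inj_on (e k) (verts H)" by metis
    define f where "f h = e (col h) h" for h
    have fA: "f h \<in> As ! (col h)" if "h \<in> verts H" for h using e col that unfolding f_def by blast
    have "inj_on f (verts H)"
    proof (rule inj_onI)
      fix u v assume uv: "u \<in> verts H" "v \<in> verts H" "f u = f v"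
      \<comment> \<open>Sides with different indices are disjoint, because they are completely
        joined and \<open>G\<close> has no loops.\<close>
      have "col u = col v"
      proof (rule ccontr)
        assume "col u \<noteq> col v"
        then have "{f u, f v} \<in> edges G" using adj fA col uv by blast
        then show False using edge_endpoints[OF G(1)] uv(3) by blast
      qed
      then show "u = v" using e[of "col u"] col uv unfolding f_def inj_on_def by metis
    qed
    moreover have "f ` verts H \<subseteq> verts G" using fA At col by blast
    moreover have "{f u, f v} \<in> edges G" if "{u, v} \<in> edges H" for u v
      using adj fA col col_ne that edge_endpoints[OF H(1) that] by metis
    ultimately show False using not_graph_freeI[OF H(1)] G(2) by blast
  qed
  then show ?thesis by blast
qed

section \<open>From most samples to a colouring of the whole graph\<close>

text \<open>Averaging over the tails. The tail found here is the sample, fixed once and for all,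
  that serves nearly all pairs \<open>u\<close>, \<open>v\<close>.\<close>

lemma exists_tail_with_few_bad_heads:
  fixes \<eta> :: real
  assumes fin: "finite V" and ne: "V \<noteq> {}"
    and few: "card {xs \<in> tuples V (Suc (Suc s)). B xs} \<le> \<eta> * card V ^ (Suc (Suc s))"
  shows "\<exists>ys\<in>tuples V s. card {(u, v). u \<in> V \<and> v \<in> V \<and> B (u # v # ys)} \<le> \<eta> * (card V)\<^sup>2"
proof (rule ccontr)
  let ?P = "\<lambda>ys. {(u, v). u \<in> V \<and> v \<in> V \<and> B (u # v # ys)}"
  assume "\<not> ?thesis"
  then have gt: "\<eta> * (card V)\<^sup>2 < card (?P ys)" if "ys \<in> tuples V s" for ys
    using that by auto
  have n0: "0 < card V" using fin ne by (simp add: card_gt_0_iff)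
  have cP: "card (?P ys) = (\<Sum>u\<in>V. \<Sum>v\<in>V. if B (u # v # ys) then 1 else 0)" for ys
  proof -
    have "?P ys = {p \<in> V \<times> V. B (fst p # snd p # ys)}" by auto
    then have "card (?P ys) = (\<Sum>p\<in>V \<times> V. if B (fst p # snd p # ys) then 1 else 0)"
      using fin by (simp add: sum.If_cases Int_def)
    then show ?thesis by (simp only: sum.cartesian_product case_prod_unfold)
  qed
  have "tuples V s \<noteq> {}" using n0 card_tuples[OF fin, of s] by auto
  then have "card V ^ s * (\<eta> * (card V)\<^sup>2) < (\<Sum>ys\<in>tuples V s. real (card (?P ys)))"
    using sum_strict_mono[of "tuples V s" "\<lambda>_. \<eta> * (card V)\<^sup>2" "\<lambda>ys. real (card (?P ys))"]
      finite_tuples[OF fin] gt by (simp add: card_tuples[OF fin])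
  also have "\<dots> = real (\<Sum>ys\<in>tuples V s. \<Sum>u\<in>V. \<Sum>v\<in>V. if B (u # v # ys) then 1 else 0)"
    by (simp only: cP of_nat_sum)
  also have "(\<Sum>ys\<in>tuples V s. \<Sum>u\<in>V. \<Sum>v\<in>V. if B (u # v # ys) then 1 else (0::nat))
      = (\<Sum>xs\<in>tuples V (Suc (Suc s)). if B xs then 1 else 0)"
    unfolding sum_tuples_Suc by (subst sum.swap, intro sum.cong refl, subst sum.swap, rule refl)
  also have "\<dots> = card {xs \<in> tuples V (Suc (Suc s)). B xs}"
    using finite_tuples[OF fin] by (simp add: sum.If_cases Int_def)
  finally show False using few by (simp add: algebra_simps power2_eq_square)
qed

text \<open>The degree condition is strong enough to survive the removal of two entries.\<close>

definition good_sample :: "('b \<Rightarrow> 'b \<Rightarrow> bool) \<Rightarrow> nat \<Rightarrow> 'b list \<Rightarrow> bool" where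
  "good_sample E r xs \<longleftrightarrow>
    (\<forall>i<length xs. (3 * r - 1) * card {j. j < length xs \<and> \<not> E (xs ! i) (xs ! j)} < 3 * (length xs - 2)) \<and>
    (\<forall>J\<subseteq>{..<length xs}. pairwise (\<lambda>i j. E (xs ! i) (xs ! j)) J \<longrightarrow> card J \<noteq> r + 1)"

text \<open>The graph lives on positions, so repeated entries are distinct non-adjacent vertices.
  The whole list is coloured at once; \<open>a\<close> and \<open>b\<close> are the colours of
  \<open>u\<close> and \<open>v\<close>. For \<open>0 < s\<close>, \<open>m\<close> is the largest
  integer with \<open>(3 * r - 1) * m < 3 * s\<close>. It depends on the length of the tail only, so
  colourings of the tail found with different pairs fall under the same uniqueness
  statement.\<close>

lemma good_sample_colouring:
  assumes sym: "symp E" and irr: "irreflp E" and r: "1 \<le> r" and good: "good_sample E r (u # v # ys)"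
  defines "s \<equiv> length ys"
  defines "m \<equiv> (3 * s - 1) div (3 * r - 1)"
  shows "\<exists>\<psi> a b. \<psi> ` {..<s} \<subseteq> {..<r} \<and> a < r \<and> b < r
    \<and> (\<forall>i\<in>{..<s}. \<forall>j\<in>{..<s}. E (ys ! i) (ys ! j) \<longrightarrow> \<psi> i \<noteq> \<psi> j)
    \<and> (\<forall>j\<in>{..<s}. E u (ys ! j) \<longrightarrow> \<psi> j \<noteq> a) \<and> (\<forall>j\<in>{..<s}. E v (ys ! j) \<longrightarrow> \<psi> j \<noteq> b)
    \<and> (E u v \<longrightarrow> a \<noteq> b)"
    and "\<And>i. i \<in> {..<s} \<Longrightarrow> card {j \<in> {..<s}. \<not> E (ys ! i) (ys ! j)} \<le> m"
    and "card {j \<in> {..<s}. \<not> E u (ys ! j)} \<le> m" and "card {j \<in> {..<s}. \<not> E v (ys ! j)} \<le> m"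
    and "(3 * r - 1) * m < 3 * s"
proof -
  define xs where "xs = u # v # ys"
  define X where "X = {..<length xs}"
  define F where "F i j \<longleftrightarrow> E (xs ! i) (xs ! j)" for i j
  have len: "length xs = s + 2" unfolding xs_def s_def by simp
  have deg: "(3 * r - 1) * card {j \<in> X. \<not> F i j} < 3 * s" if "i \<in> X" for i
    using good that unfolding good_sample_def X_def F_def xs_def[symmetric] len by auto
  have s: "0 < s" using deg[of 0] len unfolding X_def by auto
  have degm: "card {j \<in> X. \<not> F i j} \<le> m" if "i \<in> X" for i
  proof -
    have "(3 * r - 1) * card {j \<in> X. \<not> F i j} \<le> 3 * s - 1" using deg[OF that] by simp
    then show ?thesis unfolding m_def using r by (simp add: less_eq_div_iff_mult_less_eq mult.commute)
  qed
  show m: "(3 * r - 1) * m < 3 * s"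
  proof -
    have "(3 * r - 1) * m \<le> 3 * s - 1" unfolding m_def by (rule times_div_less_eq_dividend)
    then show ?thesis using s by linarith
  qed
  have cl: "card K \<le> r" if "K \<subseteq> X" "pairwise F K" for K
  proof (rule ccontr)
    assume "\<not> card K \<le> r"
    then obtain J where J: "J \<subseteq> K" "card J = r + 1" by (metis Suc_eq_plus1 not_less_eq_eq obtain_subset_with_card_n)
    then have "pairwise F J" using that(2) pairwise_subset by blast
    then show False using good J that(1) unfolding good_sample_def X_def F_def xs_def[symmetric] by auto
  qed
  have "\<exists>\<psi>. \<psi> ` X \<subseteq> {..<r} \<and> (\<forall>i\<in>X. \<forall>j\<in>X. F i j \<longrightarrow> \<psi> i \<noteq> \<psi> j)"
  proof (rule andrasfai_erdos_sos[of X F r m])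
    show "symp F" "irreflp F" using sym irr unfolding F_def symp_def irreflp_def by auto
    show "(3 * r - 1) * m < 3 * card X" using m len unfolding X_def by simp
    show "finite X" by (simp add: X_def)
    show "card K \<le> r" if "K \<subseteq> X" "pairwise F K" for K using cl that .
    show "card {j \<in> X. \<not> F i j} \<le> m" if "i \<in> X" for i using degm[OF that] .
  qed
  then obtain \<psi> where \<psi>0: "\<psi> ` X \<subseteq> {..<r} \<and> (\<forall>i\<in>X. \<forall>j\<in>X. F i j \<longrightarrow> \<psi> i \<noteq> \<psi> j)" by (rule exE)
  have \<psi>1: "\<psi> ` X \<subseteq> {..<r}" using \<psi>0 by simp
  have \<psi>: "\<psi> i \<noteq> \<psi> j" if "i \<in> X" "j \<in> X" "F i j" for i j
    using \<psi>0 that by simp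
  have X: "0 \<in> X" "1 \<in> X" "\<And>j. j \<in> {..<s} \<Longrightarrow> j + 2 \<in> X" unfolding X_def len by auto
  have nth: "xs ! 0 = u" "xs ! 1 = v" "\<And>j. xs ! (j + 2) = ys ! j" unfolding xs_def by auto
  have shift: "card {j \<in> {..<s}. \<not> E (xs ! i) (ys ! j)} \<le> m" if "i \<in> X" for i
  proof -
    have "card {j \<in> {..<s}. \<not> E (xs ! i) (ys ! j)} = card ((\<lambda>j. j + 2) ` {j \<in> {..<s}. \<not> E (xs ! i) (ys ! j)})"
      by (intro card_image[symmetric] inj_onI) simp
    also have "\<dots> \<le> card {j \<in> X. \<not> F i j}"
      using X nth(3) unfolding F_def X_def by (intro card_mono) auto
    finally show ?thesis using degm[OF that] by linarith
  qed
  show "card {j \<in> {..<s}. \<not> E u (ys ! j)} \<le> m" "card {j \<in> {..<s}. \<not> E v (ys ! j)} \<le> m"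
    using shift[OF X(1)] shift[OF X(2)] nth by auto
  show "card {j \<in> {..<s}. \<not> E (ys ! i) (ys ! j)} \<le> m" if "i \<in> {..<s}" for i
    using shift[OF X(3)[OF that]] nth(3) by simp
  show "\<exists>\<psi> a b. \<psi> ` {..<s} \<subseteq> {..<r} \<and> a < r \<and> b < r
    \<and> (\<forall>i\<in>{..<s}. \<forall>j\<in>{..<s}. E (ys ! i) (ys ! j) \<longrightarrow> \<psi> i \<noteq> \<psi> j)
    \<and> (\<forall>j\<in>{..<s}. E u (ys ! j) \<longrightarrow> \<psi> j \<noteq> a) \<and> (\<forall>j\<in>{..<s}. E v (ys ! j) \<longrightarrow> \<psi> j \<noteq> b)
    \<and> (E u v \<longrightarrow> a \<noteq> b)"
  proof (rule exI[of _ "\<lambda>j. \<psi> (j + 2)"], rule exI[of _ "\<psi> 0"], rule exI[of _ "\<psi> 1"], intro conjI ballI impI)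
    show "(\<lambda>j. \<psi> (j + 2)) ` {..<s} \<subseteq> {..<r}" "\<psi> 0 < r" "\<psi> 1 < r" using \<psi>1 X by blast+
    show "\<psi> (i + 2) \<noteq> \<psi> (j + 2)" if "i \<in> {..<s}" "j \<in> {..<s}" "E (ys ! i) (ys ! j)" for i j
      using \<psi>[OF X(3) X(3)] that nth unfolding F_def by metis
    show "\<psi> (j + 2) \<noteq> \<psi> 0" if "j \<in> {..<s}" "E u (ys ! j)" for j
      using \<psi>[OF X(1) X(3)] that nth unfolding F_def by metis
    show "\<psi> (j + 2) \<noteq> \<psi> 1" if "j \<in> {..<s}" "E v (ys ! j)" for j
      using \<psi>[OF X(2) X(3)] that nth unfolding F_def by metis
    show "\<psi> 0 \<noteq> \<psi> 1" if "E u v" using \<psi>[OF X(1) X(2)] that nth unfolding F_def by metis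
  qed
qed

text \<open>One colouring \<open>\<phi>\<close> of the tail is fixed, and \<open>v\<close> gets a
  colour absent from its neighbours there. A good edge \<open>u v\<close> brings its own colouring
  \<open>\<psi>\<close>, in which \<open>u\<close> and \<open>v\<close> have colours
  \<open>a \<noteq> b\<close>. As \<open>\<phi>\<close> and \<open>\<psi>\<close> induce the same
  partition of the tail, \<open>c u\<close> and \<open>c v\<close> are the names of \<open>a\<close>
  and \<open>b\<close> in \<open>\<phi>\<close>, hence different.\<close>

lemma colouring_from_sample:
  assumes sym: "symp E" and irr: "irreflp E" and r: "1 \<le> r"
  shows "\<exists>c. (\<forall>v. c v < r) \<and> (\<forall>u v. E u v \<longrightarrow> good_sample E r (u # v # ys) \<longrightarrow> c u \<noteq> c v)"
proof (cases "\<exists>u v. good_sample E r (u # v # ys)")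
  case False
  then show ?thesis using r by (intro exI[of _ "\<lambda>_. 0"]) auto
next
  case True
  then obtain u\<^sub>0 v\<^sub>0 where good0: "good_sample E r (u\<^sub>0 # v\<^sub>0 # ys)" by blast
  define S where "S = {..<length ys}"
  define m where "m = (3 * length ys - 1) div (3 * r - 1)"
  define F where "F i j \<longleftrightarrow> E (ys ! i) (ys ! j)" for i j
  have F: "symp F" using sym unfolding F_def symp_def by auto
  have S: "finite S" "card S = length ys" unfolding S_def by auto
  note samp = good_sample_colouring[where ys = ys, OF sym irr r, folded S_def m_def F_def]
  obtain \<phi> where "\<phi> ` S \<subseteq> {..<r} \<and> (\<forall>i\<in>S. \<forall>j\<in>S. F i j \<longrightarrow> \<phi> i \<noteq> \<phi> j)"
    using samp(1)[OF good0] by (elim exE conjE) (rule that, rule conjI)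
  then have \<phi>: "\<phi> ` S \<subseteq> {..<r}" "\<And>i j. i \<in> S \<Longrightarrow> j \<in> S \<Longrightarrow> F i j \<Longrightarrow> \<phi> i \<noteq> \<phi> j"
    by simp_all
  have deg: "\<And>i. i \<in> S \<Longrightarrow> card {j \<in> S. \<not> F i j} \<le> m" using samp(2)[OF good0] .
  have m: "(3 * r - 1) * m < 3 * card S" using samp(5)[OF good0] S by simp
  define avail where "avail v i \<longleftrightarrow> i < r \<and> (\<forall>j\<in>S. E v (ys ! j) \<longrightarrow> \<phi> j \<noteq> i)" for v i
  \<comment> \<open>The default \<open>0\<close> keeps \<open>c v < r\<close>; endpoints of a good
    edge always have an available colour.\<close>
  define c where "c v = (if \<exists>i. avail v i then SOME i. avail v i else 0)" for v
  have c_avail: "avail v (c v)" if "avail v i" for v i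
    using that someI[of "avail v" i] unfolding c_def by auto
  have "c v < r" for v
  proof (cases "\<exists>i. avail v i")
    case True
    then show ?thesis using c_avail unfolding avail_def by blast
  next
    case False
    then have "c v = 0" unfolding c_def by (rule if_not_P)
    then show ?thesis using r by simp
  qed
  moreover have "c u \<noteq> c v" if uv: "E u v" and good: "good_sample E r (u # v # ys)" for u v
  proof -
    obtain \<psi> a b where col: "\<psi> ` S \<subseteq> {..<r} \<and> a < r \<and> b < r
      \<and> (\<forall>i\<in>S. \<forall>j\<in>S. F i j \<longrightarrow> \<psi> i \<noteq> \<psi> j)
      \<and> (\<forall>j\<in>S. E u (ys ! j) \<longrightarrow> \<psi> j \<noteq> a) \<and> (\<forall>j\<in>S. E v (ys ! j) \<longrightarrow> \<psi> j \<noteq> b)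
      \<and> (E u v \<longrightarrow> a \<noteq> b)"
      using samp(1)[OF good] by (elim exE)
    have \<psi>: "\<psi> ` S \<subseteq> {..<r}" "\<And>i j. i \<in> S \<Longrightarrow> j \<in> S \<Longrightarrow> F i j \<Longrightarrow> \<psi> i \<noteq> \<psi> j"
      and ab: "a < r" "b < r" "a \<noteq> b"
      and a: "\<And>j. j \<in> S \<Longrightarrow> E u (ys ! j) \<Longrightarrow> \<psi> j \<noteq> a" and b: "\<And>j. j \<in> S \<Longrightarrow> E v (ys ! j) \<Longrightarrow> \<psi> j \<noteq> b"
      using col uv by simp_all
    \<comment> \<open>The colour \<open>d\<close> occurs in the tail, since the other
      \<open>r - 1\<close> classes have at most \<open>m\<close> positions each. The
      \<open>\<phi>\<close>-colour of such a position is available for \<open>w\<close>, and at most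
      one colour is.\<close>
    have rep: "\<exists>j\<in>S. \<psi> j = d \<and> c w = \<phi> j"
      if d: "d < r" and dw: "\<And>j. j \<in> S \<Longrightarrow> E w (ys ! j) \<Longrightarrow> \<psi> j \<noteq> d"
        and w: "card {j \<in> S. \<not> E w (ys ! j)} \<le> m" for d w
    proof -
      have "card S \<le> card {j \<in> S. \<psi> j \<in> {d}} + card ({..<r} - {d}) * m"
        by (rule card_le_colour_classes[of S "{..<r}" \<psi> F m "{d}", OF S(1) _ \<psi> deg]) auto
      moreover have "3 * (card ({..<r} - {d}) * m) \<le> (3 * r - 1) * m"
      proof -
        have "3 * card ({..<r} - {d}) \<le> 3 * r - 1" using d by simp
        then show ?thesis by (metis mult.assoc mult_right_mono zero_le)
      qed
      ultimately have "card {j \<in> S. \<psi> j \<in> {d}} \<noteq> 0" using m by linarith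
      then have "{j \<in> S. \<psi> j \<in> {d}} \<noteq> {}" by (metis card.empty)
      then obtain j where j: "j \<in> S" "\<psi> j = d" by auto
      have "avail w (\<phi> j)"
        unfolding avail_def
      proof (intro conjI ballI impI notI)
        show "\<phi> j < r" using \<phi>(1) j by auto
        fix i assume i: "i \<in> S" "E w (ys ! i)" "\<phi> i = \<phi> j"
        have "\<psi> i = \<psi> j"
          by (rule colouring_unique[of S F "{..<r}" r "{..<r}" \<phi> \<psi> m, OF S(1) F _ _ _ _ \<phi> \<psi> deg m])
            (use i j in auto)
        then show False using dw i j by blast
      qed
      moreover from this have "avail w (c w)" by (rule c_avail)
      ultimately have "c w = \<phi> j"
        unfolding avail_def
        by (intro missing_colour_unique[of S "{..<r}" r \<phi> F m "\<lambda>j. E w (ys ! j)" "c w" "\<phi> j",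
              OF S(1) _ _ \<phi> deg m w]) simp_all
      then show ?thesis using j by blast
    qed
    obtain i where i: "i \<in> S" "\<psi> i = a" "c u = \<phi> i" using rep[OF ab(1) a samp(3)[OF good]] by blast
    obtain j where j: "j \<in> S" "\<psi> j = b" "c v = \<phi> j" using rep[OF ab(2) b samp(4)[OF good]] by blast
    show ?thesis
    proof
      assume "c u = c v"
      have "\<psi> i = \<psi> j"
        by (rule colouring_unique[of S F "{..<r}" r "{..<r}" \<phi> \<psi> m, OF S(1) F _ _ _ _ \<phi> \<psi> deg m])
          (use i j \<open>c u = c v\<close> in auto)
      then show False using i j ab by simp
    qed
  qed
  ultimately show ?thesis by blast
qed

text \<open>The factor \<open>M\<close> is the price of a union bound over the positions of the
  sample; \<open>exp x \<ge> x\<^sup>2 / 2\<close> already beats it.\<close>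

lemma exists_sample_size:
  fixes a \<eta> :: real
  assumes "0 < a" "0 < \<eta>"
  shows "\<exists>M::nat. 2 \<le> M \<and> M * exp (3 - a * M) \<le> \<eta>"
proof -
  define K where "K = 2 * exp 3 / (a\<^sup>2 * \<eta>)"
  define M where "M = nat \<lceil>K\<rceil> + 2"
  have KM: "K \<le> M" unfolding M_def by linarith
  have M0: "0 < real M" unfolding M_def by simp
  have aM: "0 < a * M" using assms M0 by simp
  have "(a * M)\<^sup>2 / 2 \<le> exp (a * M)"
    using exp_lower_Taylor_quadratic[of "a * M"] aM by linarith
  then have "exp 3 / exp (a * M) \<le> exp 3 / ((a * M)\<^sup>2 / 2)"
    using aM M0 by (intro divide_left_mono mult_pos_pos) auto
  then have "M * exp (3 - a * M) \<le> M * (exp 3 / ((a * M)\<^sup>2 / 2))"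
    unfolding exp_diff using M0 by (intro mult_left_mono) auto
  also have "\<dots> = K * \<eta> / M" unfolding K_def using assms M0 by (simp add: field_simps power2_eq_square)
  also have "\<dots> \<le> \<eta>" using KM M0 assms by (simp add: divide_le_eq mult.commute)
  finally show ?thesis unfolding M_def by (intro exI[of _ M]) (simp add: M_def)
qed

lemma card_nonneighbours_le:
  fixes c :: real
  assumes G: "simple_graph G" and v: "v \<in> verts G" and c: "c * card (verts G) \<le> min_degree G"
  shows "card {u \<in> verts G. {v, u} \<notin> edges G} \<le> (1 - c) * card (verts G)"
proof -
  have fin: "finite (verts G)" using G by (simp add: simple_graph_def)
  have "min_degree G \<le> degree G v" unfolding min_degree_def using fin v by (intro Min_le) auto
  moreover have "card (verts G) = degree G v + card {u \<in> verts G. {v, u} \<notin> edges G}"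
    unfolding degree_def using fin
    by (subst card_Un_disjoint[symmetric]) (auto intro: arg_cong[where f = card] simp: insert_commute)
  ultimately have "real (card {u \<in> verts G. {v, u} \<notin> edges G}) \<le> real (card (verts G)) - real (min_degree G)" by linarith
  then show ?thesis using c by (simp add: algebra_simps)
qed

text \<open>A sample fails if some entry has too many non-neighbours in it, which is rare by
  Chernoff's bound, or if it contains a clique of size \<open>r + 1\<close>, which is rare because
  \<open>G\<close> is \<open>H\<close>-free. Each cause gets half of \<open>\<eta>\<close>. The size
  \<open>M\<close> is fixed before \<open>n\<^sub>0\<close>, as the bound on cliques depends on
  it.\<close>

lemma minimum_degree_stability:
  fixes H :: "'a graph" and c \<eta> :: real
  assumes H: "simple_graph H" "partite (r + 1) H" and r: "2 \<le> r"
    and c: "1 - 1 / (real r - 1 / 3) < c" "c \<le> 1" and \<eta>: "0 < \<eta>"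
  shows "\<exists>n\<^sub>0. \<forall>G :: 'b graph. simple_graph G \<longrightarrow> graph_free H G \<longrightarrow> n\<^sub>0 \<le> card (verts G) \<longrightarrow>
    c * card (verts G) \<le> min_degree G \<longrightarrow> partite_after_deleting r (\<eta> * (card (verts G))\<^sup>2) G"
proof -
  define w where "w = 3 / (3 * real r - 1)"
  have w: "1 / (real r - 1 / 3) = w" "0 < w" "w \<le> 1" using r unfolding w_def by (auto simp: field_simps)
  \<comment> \<open>The proportion of non-neighbours is at most
    \<open>1 - c = w - 2 * \<epsilon>\<close>. Chernoff's bound with
    \<open>\<beta> = \<epsilon>\<close> gains \<open>2 * \<epsilon>\<^sup>2 * M\<close> in the
    exponent and loses at most \<open>\<epsilon>\<^sup>2 * M\<close> to the quadratic term. The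
    constant 3 absorbs \<open>\<epsilon> + 2 * (\<epsilon> * w)\<close>.\<close>
  define \<epsilon> where "\<epsilon> = (c - (1 - w)) / 2"
  have \<epsilon>: "0 < \<epsilon>" "\<epsilon> \<le> 1" "1 - c = w - 2 * \<epsilon>" using c[unfolded w(1)] w(2,3) unfolding \<epsilon>_def by (simp_all add: field_simps)
  obtain M :: nat where M: "2 \<le> M" "M * exp (3 - \<epsilon>\<^sup>2 * M) \<le> \<eta> / 2"
    using exists_sample_size[of "\<epsilon>\<^sup>2" "\<eta> / 2"] \<epsilon> \<eta> by auto
  obtain s where s: "M = Suc (Suc s)" using M(1) by (metis add_2_eq_Suc le_Suc_ex)
  define \<gamma> where "\<gamma> = \<eta> / (2 * 2 ^ M)"
  have \<gamma>: "0 < \<gamma>" unfolding \<gamma>_def using \<eta> by simp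
  obtain n\<^sub>0 where n0: "\<And>(G :: 'b graph) J. simple_graph G \<Longrightarrow> graph_free H G \<Longrightarrow> n\<^sub>0 \<le> card (verts G) \<Longrightarrow>
    J \<subseteq> {..<M} \<Longrightarrow> card J = r + 1 \<Longrightarrow>
    card {xs \<in> tuples (verts G) M. pairwise (\<lambda>i j. {xs ! i, xs ! j} \<in> edges G) J} < \<gamma> * card (verts G) ^ M"
    using few_clique_tuples[OF H \<gamma>, of M] by blast
  have "partite_after_deleting r (\<eta> * (card (verts G))\<^sup>2) G"
    if G: "simple_graph G" "graph_free H G" and n: "Suc n\<^sub>0 \<le> card (verts G)"
      and min: "c * card (verts G) \<le> min_degree G" for G :: "'b graph"
  proof -
    define V where "V = verts G"
    define E where "E u v \<longleftrightarrow> {u, v} \<in> edges G" for u v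
    have V: "finite V" "V \<noteq> {}" using G(1) n by (auto simp: V_def simple_graph_def)
    have E: "symp E" "irreflp E"
      using edge_endpoints(3)[OF G(1)] unfolding E_def by (auto intro!: sympI irreflpI simp: insert_commute)
    have nondeg: "card {u \<in> V. \<not> E v u} \<le> (1 - c) * card V" if "v \<in> V" for v
      using card_nonneighbours_le[OF G(1) _ min] that unfolding V_def E_def by blast
    \<comment> \<open>With \<open>s = M - 2\<close>, this is exactly the number of non-neighbours
      from which the degree condition of \<open>good_sample\<close> fails.\<close>
    define \<tau> where "\<tau> = w * s"
    define D where "D i = {xs \<in> tuples V M. \<tau> \<le> card {j. j < M \<and> \<not> E (xs ! i) (xs ! j)}}" for i
    define C where "C J = {xs \<in> tuples V M. pairwise (\<lambda>i j. E (xs ! i) (xs ! j)) J}" for J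
    define Js where "Js = {J. J \<subseteq> {..<M} \<and> card J = r + 1}"
    have Js: "finite Js" "card Js \<le> 2 ^ M"
      using card_mono[of "Pow {..<M}" Js] by (auto simp: Js_def card_Pow)
    have cD: "card (D i) \<le> exp (3 - \<epsilon>\<^sup>2 * M) * card V ^ M" if "i < M" for i
    proof -
      have "card (D i) \<le> exp (\<epsilon> + (1 - c) * (\<epsilon> + \<epsilon>\<^sup>2) * M - \<epsilon> * \<tau>) * card V ^ M"
        unfolding D_def
        by (rule few_tuples_with_many_related_entries[OF V(1) that])
          (use \<epsilon> c nondeg in auto)
      also have "\<dots> \<le> exp (3 - \<epsilon>\<^sup>2 * M) * card V ^ M"
      proof (intro mult_right_mono, subst exp_le_cancel_iff)
        have "(1 - c) * (\<epsilon> + \<epsilon>\<^sup>2) * M - \<epsilon> * \<tau> = (1 - c) * \<epsilon>\<^sup>2 * M - 2 * \<epsilon>\<^sup>2 * M + 2 * (\<epsilon> * w)"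
          unfolding \<tau>_def \<epsilon>(3) s by (simp add: algebra_simps power2_eq_square)
        also have "(1 - c) * \<epsilon>\<^sup>2 * M \<le> 1 * \<epsilon>\<^sup>2 * M"
          using \<epsilon>(3) \<epsilon>(1) w by (intro mult_right_mono) auto
        also have "\<epsilon> * w \<le> 1 * 1" using \<epsilon> w by (intro mult_mono) auto
        finally show "\<epsilon> + (1 - c) * (\<epsilon> + \<epsilon>\<^sup>2) * M - \<epsilon> * \<tau> \<le> 3 - \<epsilon>\<^sup>2 * M"
          using \<epsilon>(2) by (simp add: mult.commute[of "\<epsilon>\<^sup>2" "real M"])
      qed simp
      finally show ?thesis .
    qed
    have cC: "card (C J) \<le> \<gamma> * card V ^ M" if "J \<in> Js" for J
      using n0[OF G, of J] n that unfolding C_def E_def V_def Js_def by simp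
    have "{xs \<in> tuples V M. \<not> good_sample E r xs} \<subseteq> (\<Union>i<M. D i) \<union> (\<Union>J\<in>Js. C J)"
    proof
      fix xs assume xs: "xs \<in> {xs \<in> tuples V M. \<not> good_sample E r xs}"
      then have len: "length xs = M" and bad: "\<not> good_sample E r xs" by (simp_all add: tuples_def)
      consider i where "i < M" "3 * s \<le> (3 * r - 1) * card {j. j < M \<and> \<not> E (xs ! i) (xs ! j)}"
        | J where "J \<subseteq> {..<M}" "pairwise (\<lambda>i j. E (xs ! i) (xs ! j)) J" "card J = r + 1"
        using bad unfolding good_sample_def len by (auto simp: s not_less)
      then show "xs \<in> (\<Union>i<M. D i) \<union> (\<Union>J\<in>Js. C J)"
      proof cases
        case 1
        have "real (3 * s) \<le> real ((3 * r - 1) * card {j. j < M \<and> \<not> E (xs ! i) (xs ! j)})"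
          using 1(2) by (simp only: of_nat_le_iff)
        then have "\<tau> \<le> card {j. j < M \<and> \<not> E (xs ! i) (xs ! j)}"
          using r unfolding \<tau>_def w_def by (simp add: of_nat_diff divide_le_eq mult.commute)
        then show ?thesis using 1(1) xs unfolding D_def by blast
      next
        case 2
        then show ?thesis using xs unfolding C_def Js_def by blast
      qed
    qed
    then have "card {xs \<in> tuples V M. \<not> good_sample E r xs} \<le> card ((\<Union>i<M. D i) \<union> (\<Union>J\<in>Js. C J))"
      using finite_tuples[OF V(1)] Js(1) unfolding D_def C_def by (intro card_mono) auto
    also have "\<dots> \<le> (\<Sum>i<M. card (D i)) + (\<Sum>J\<in>Js. card (C J))"
      using card_UN_le[of "{..<M}" D] card_UN_le[OF Js(1), of C] card_Un_le[of "\<Union>i<M. D i" "\<Union>J\<in>Js. C J"] by simp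
    finally have "real (card {xs \<in> tuples V M. \<not> good_sample E r xs})
        \<le> (\<Sum>i<M. real (card (D i))) + (\<Sum>J\<in>Js. real (card (C J)))"
      by (simp flip: of_nat_sum of_nat_add)
    also have "\<dots> \<le> M * (exp (3 - \<epsilon>\<^sup>2 * M) * card V ^ M) + card Js * (\<gamma> * card V ^ M)"
      using sum_bounded_above[of "{..<M}" "\<lambda>i. real (card (D i))"] cD
        sum_bounded_above[of Js "\<lambda>J. real (card (C J))"] cC
      by (intro add_mono) auto
    also have "\<dots> \<le> \<eta> / 2 * card V ^ M + 2 ^ M * (\<gamma> * card V ^ M)"
    proof (rule add_mono)
      show "M * (exp (3 - \<epsilon>\<^sup>2 * M) * card V ^ M) \<le> \<eta> / 2 * card V ^ M"
        using mult_right_mono[OF M(2), of "real (card V ^ M)"] by (simp add: mult.assoc)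
      have "real (card Js) \<le> real (2 ^ M)" using Js(2) by (simp only: of_nat_le_iff)
      then show "card Js * (\<gamma> * card V ^ M) \<le> 2 ^ M * (\<gamma> * card V ^ M)"
        using \<gamma> by (intro mult_right_mono) auto
    qed
    also have "\<dots> = \<eta> * card V ^ M" unfolding \<gamma>_def by (simp add: field_simps)
    finally obtain ys where
      ys: "card {(u, v). u \<in> V \<and> v \<in> V \<and> \<not> good_sample E r (u # v # ys)} \<le> \<eta> * (card V)\<^sup>2"
      using exists_tail_with_few_bad_heads[OF V, of s "\<lambda>xs. \<not> good_sample E r xs" \<eta>] unfolding s by auto
    let ?P = "{(u, v). u \<in> V \<and> v \<in> V \<and> \<not> good_sample E r (u # v # ys)}"
    have finP: "finite ?P" by (rule finite_subset[of _ "V \<times> V"]) (use V in auto)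
    obtain col where col: "\<And>v. col v < r" "\<And>u v. E u v \<Longrightarrow> good_sample E r (u # v # ys) \<Longrightarrow> col u \<noteq> col v"
      using colouring_from_sample[OF E, of r ys] r by auto
    \<comment> \<open>An edge goes as soon as one of its two orders is bad, so deleted edges are
      charged to bad ordered pairs and remaining edges are properly coloured in either
      order.\<close>
    define B where "B = {e \<in> edges G. \<exists>u v. e = {u, v} \<and> \<not> good_sample E r (u # v # ys)}"
    have "B \<subseteq> (\<lambda>(u, v). {u, v}) ` ?P"
    proof
      fix e assume "e \<in> B"
      then obtain u v where uv: "e = {u, v}" "{u, v} \<in> edges G" "\<not> good_sample E r (u # v # ys)" unfolding B_def by auto
      then have "(u, v) \<in> ?P" using edge_endpoints[OF G(1) uv(2)] unfolding V_def by auto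
      then show "e \<in> (\<lambda>(u, v). {u, v}) ` ?P" using uv(1) by force
    qed
    then have "card B \<le> card ?P" using finP by (rule surj_card_le[rotated])
    then have "card B \<le> \<eta> * (card V)\<^sup>2" using ys by linarith
    moreover have "partite r (G\<lparr>edges := edges G - B\<rparr>)"
      unfolding partite_def using col unfolding B_def E_def by (intro exI[of _ col]) auto
    moreover have "B \<subseteq> edges G" unfolding B_def by auto
    ultimately show ?thesis unfolding partite_after_deleting_def V_def by blast
  qed
  then show ?thesis by blast
qed

section \<open>The lower bound\<close>

lemma join_edge_Inl_Inl:
  fixes G :: "'a graph" and F :: "'b graph"
  shows "{Inl u, Inl v} \<in> edges (graph_join G F) \<longleftrightarrow> {u, v} \<in> edges G"
proof -
  let ?i = "Inl :: 'a \<Rightarrow> 'a + 'b"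
  have "?i ` {u, v} \<noteq> Inr ` e" for e by auto
  then have "?i ` {u, v} \<notin> image Inr ` edges F" by blast
  then have "{?i u, ?i v} \<in> edges (graph_join G F) \<longleftrightarrow> ?i ` {u, v} \<in> image ?i ` edges G"
    unfolding graph_join_def by (simp add: doubleton_eq_iff)
  also have "\<dots> \<longleftrightarrow> {u, v} \<in> edges G"
    by (rule inj_image_mem_iff) (simp add: inj_image_eq_iff inj_def)
  finally show ?thesis .
qed

lemma join_edge_Inr_Inr:
  fixes G :: "'a graph" and F :: "'b graph"
  shows "{Inr u, Inr v} \<in> edges (graph_join G F) \<longleftrightarrow> {u, v} \<in> edges F"
proof -
  let ?i = "Inr :: 'b \<Rightarrow> 'a + 'b"
  have "?i ` {u, v} \<noteq> Inl ` e" for e by auto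
  then have "?i ` {u, v} \<notin> image Inl ` edges G" by blast
  then have "{?i u, ?i v} \<in> edges (graph_join G F) \<longleftrightarrow> ?i ` {u, v} \<in> image ?i ` edges F"
    unfolding graph_join_def by (simp add: doubleton_eq_iff)
  also have "\<dots> \<longleftrightarrow> {u, v} \<in> edges F"
    by (rule inj_image_mem_iff) (simp add: inj_image_eq_iff inj_def)
  finally show ?thesis .
qed

lemma join_edge_Inl_Inr: "{Inl u, Inr v} \<in> edges (graph_join G F) \<longleftrightarrow> u \<in> verts G \<and> v \<in> verts F"
  unfolding graph_join_def by (auto simp: doubleton_eq_iff)

lemma complete_graph_edge: "{u, v} \<in> edges (complete_graph k) \<longleftrightarrow> u < k \<and> v < k \<and> u \<noteq> v"
  unfolding complete_graph_def by (auto simp: doubleton_in_nsets_2)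

lemma simple_complete_graph: "simple_graph (complete_graph k)"
  unfolding simple_graph_def complete_graph_def by simp

lemma simple_cycle_graph: "3 \<le> m \<Longrightarrow> simple_graph (cycle_graph m)"
proof -
  assume m: "3 \<le> m"
  have "(i + 1) mod m < m \<and> i \<noteq> (i + 1) mod m" if "i < m" for i
    using that m by (cases "i + 1 = m") auto
  then show ?thesis unfolding simple_graph_def cycle_graph_def by auto
qed

lemma cycle_graph_edge_Suc: "Suc j < m \<Longrightarrow> {j, Suc j} \<in> edges (cycle_graph m)"
  unfolding cycle_graph_def by (auto intro!: exI[of _ j])

lemma cycle_graph_edge_last: "0 < m \<Longrightarrow> {m - 1, 0} \<in> edges (cycle_graph m)"
  unfolding cycle_graph_def by (auto intro!: exI[of _ "m - 1"])

lemma simple_graph_join: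
  assumes "simple_graph G" "simple_graph F"
  shows "simple_graph (graph_join G F)"
  unfolding simple_graph_def
proof
  show "finite (verts (graph_join G F))" using assms by (simp add: graph_join_def simple_graph_def)
  show "edges (graph_join G F) \<subseteq> nsets (verts (graph_join G F)) 2"
  proof
    fix e assume "e \<in> edges (graph_join G F)"
    then consider e' where "e' \<in> edges G" "e = Inl ` e'" | e' where "e' \<in> edges F" "e = Inr ` e'"
      | u v where "u \<in> verts G" "v \<in> verts F" "e = {Inl u, Inr v}"
      unfolding graph_join_def by auto
    then show "e \<in> nsets (verts (graph_join G F)) 2"
    proof cases
      case 1
      obtain u v where "e' = {u, v}" "u \<noteq> v" "u \<in> verts G" "v \<in> verts G"
        using edge_cases[OF assms(1) 1(1)] .
      then show ?thesis using 1(2) by (simp add: graph_join_def InlI)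
    next
      case 2
      obtain u v where "e' = {u, v}" "u \<noteq> v" "u \<in> verts F" "v \<in> verts F"
        using edge_cases[OF assms(2) 2(1)] .
      then show ?thesis using 2(2) by (simp add: graph_join_def InrI)
    next
      case 3
      then show ?thesis by (simp add: graph_join_def InlI InrI)
    qed
  qed
qed

text \<open>The complete part uses up \<open>r - 2\<close> colours, so two are left for the cycle.
  Steps of length two then carry the colour of \<open>0\<close> to \<open>2 * g\<close>, which is
  joined to \<open>0\<close>.\<close>

lemma not_partite_join_odd_cycle:
  assumes r: "2 \<le> r"
  shows "\<not> partite r (graph_join (complete_graph (r - 2)) (cycle_graph (2 * g + 1)))" (is "\<not> partite r ?B")
proof
  assume "partite r ?B"
  then obtain c where c: "c ` verts ?B \<subseteq> {..<r}" "\<And>u v. {u, v} \<in> edges ?B \<Longrightarrow> c u \<noteq> c v"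
    unfolding partite_def by blast
  define A where "A = (\<lambda>i. c (Inl i)) ` {..<r - 2}"
  have vB: "Inl i \<in> verts ?B \<longleftrightarrow> i < r - 2" "Inr j \<in> verts ?B \<longleftrightarrow> j < 2 * g + 1" for i j
    by (auto simp: graph_join_def complete_graph_def cycle_graph_def)
  have "inj_on (\<lambda>i. c (Inl i)) {..<r - 2}"
  proof (rule inj_onI, rule ccontr)
    fix i j assume "i \<in> {..<r - 2}" "j \<in> {..<r - 2}" "c (Inl i) = c (Inl j)" "i \<noteq> j"
    then show False using c(2)[of "Inl i" "Inl j"] by (simp add: join_edge_Inl_Inl complete_graph_edge)
  qed
  then have "card A = r - 2" unfolding A_def by (simp add: card_image)
  moreover have "A \<subseteq> {..<r}" using c(1) vB unfolding A_def by blast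
  ultimately have "card ({..<r} - A) = 2" using r by (subst card_Diff_subset) (auto intro: finite_subset)
  then obtain x y where xy: "{..<r} - A = {x, y}" by (auto simp: card_2_iff)
  define d where "d j = c (Inr j)" for j
  have d: "d j \<in> {x, y}" if "j < 2 * g + 1" for j
  proof -
    have "c (Inl i) \<noteq> d j" if "i < r - 2" for i
      using c(2)[of "Inl i" "Inr j"] that \<open>j < 2 * g + 1\<close>
      unfolding d_def by (simp add: join_edge_Inl_Inr complete_graph_def cycle_graph_def)
    then have "d j \<notin> A" unfolding A_def by force
    moreover have "d j \<in> {..<r}" using c(1) vB(2) that unfolding d_def by blast
    ultimately show ?thesis using xy by blast
  qed
  have step: "d j \<noteq> d (Suc j)" if "Suc j < 2 * g + 1" for j
    using c(2)[of "Inr j" "Inr (Suc j)"] cycle_graph_edge_Suc[OF that] unfolding d_def by (simp add: join_edge_Inr_Inr)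
  have "d (2 * j) = d 0" if "j \<le> g" for j
    using that
  proof (induction j)
    case (Suc j)
    have "d (2 * j) \<noteq> d (Suc (2 * j))" "d (Suc (2 * j)) \<noteq> d (Suc (Suc (2 * j)))"
      using Suc.prems by (auto intro!: step)
    moreover have "d (2 * j) \<in> {x, y}" "d (Suc (2 * j)) \<in> {x, y}" "d (Suc (Suc (2 * j))) \<in> {x, y}"
      using Suc.prems by (auto intro!: d simp del: insert_iff)
    ultimately have "d (Suc (Suc (2 * j))) = d (2 * j)" by auto
    then show ?case using Suc by simp
  qed simp
  then have "d (2 * g) = d 0" by blast
  moreover have "d (2 * g) \<noteq> d 0"
    using c(2)[of "Inr (2 * g)" "Inr 0"] cycle_graph_edge_last[of "2 * g + 1"]
    unfolding d_def by (simp add: join_edge_Inr_Inr)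
  ultimately show False by blast
qed

text \<open>A vertex set smaller than the cycle misses one of its vertices; cutting the cycle there leaves
  a path, which is bipartite.\<close>

lemma homomorphic_to_join_long_cycle_imp_partite:
  assumes H: "simple_graph H" and hom: "homomorphic H (graph_join (complete_graph (r - 2)) (cycle_graph m))"
    and small: "card (verts H) < m" and r: "2 \<le> r"
  shows "partite r H"
proof -
  let ?B = "graph_join (complete_graph (r - 2)) (cycle_graph m)"
  obtain f where f: "f ` verts H \<subseteq> verts ?B" "\<And>u v. {u, v} \<in> edges H \<Longrightarrow> {f u, f v} \<in> edges ?B"
    using hom unfolding homomorphic_def by blast
  have fin: "finite (f ` verts H)" using H by (simp add: simple_graph_def)
  have "card (Inr ` {..<m} :: (nat + nat) set) = m" by (simp add: card_image)
  moreover have "card (f ` verts H) < m" using small H card_image_le[of "verts H" f]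
    by (simp add: simple_graph_def)
  ultimately have "\<not> Inr ` {..<m} \<subseteq> f ` verts H" using card_mono[OF fin, of "Inr ` {..<m}"] by auto
  then obtain p where p: "p < m" "Inr p \<notin> f ` verts H" by auto
  \<comment> \<open>The position on the path that starts right after \<open>p\<close>. It grows by
    one along each edge avoiding \<open>p\<close>, also from \<open>m - 1\<close> to
    \<open>0\<close>, so its parity is a proper colouring.\<close>
  define pos where "pos j = (if p < j then j - p - 1 else j + m - 1 - p)" for j
  define col where "col z = (case z of Inl i \<Rightarrow> i | Inr j \<Rightarrow> r - 2 + pos j mod 2)" for z
  have pos_ne: "pos i mod 2 \<noteq> pos ((i + 1) mod m) mod 2" if "i < m" "i \<noteq> p" "(i + 1) mod m \<noteq> p" for i
  proof (cases "i + 1 = m")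
    case True
    then have "pos ((i + 1) mod m) = Suc (pos i)" using that p(1) unfolding pos_def by auto
    then show ?thesis by presburger
  next
    case False
    then have "(i + 1) mod m = i + 1" using that by simp
    then have "pos ((i + 1) mod m) = Suc (pos i)" using that p(1) unfolding pos_def by auto
    then show ?thesis by presburger
  qed
  have cyc: "pos i mod 2 \<noteq> pos j mod 2" if ij: "{i, j} \<in> edges (cycle_graph m)" "i \<noteq> p" "j \<noteq> p" for i j
  proof -
    obtain k where k: "k < m" "{i, j} = {k, (k + 1) mod m}" using ij(1) unfolding cycle_graph_def by auto
    then consider "i = k" "j = (k + 1) mod m" | "j = k" "i = (k + 1) mod m" by (auto simp: doubleton_eq_iff)
    then show ?thesis
    proof cases
      case 1
      then show ?thesis using pos_ne[OF k(1)] ij by simp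
    next
      case 2
      then show ?thesis using pos_ne[OF k(1)] ij by metis
    qed
  qed
  have vB: "Inl i \<in> verts ?B \<longleftrightarrow> i < r - 2" for i
    by (auto simp: graph_join_def complete_graph_def)
  have "col (f v) < r" if "v \<in> verts H" for v
  proof (cases "f v")
    case (Inl i)
    then have "i < r - 2" using f(1) that vB by (metis image_subset_iff)
    then show ?thesis unfolding col_def Inl by simp
  next
    case (Inr j)
    have "pos j mod 2 < 2" by simp
    then show ?thesis unfolding col_def Inr using r by simp
  qed
  moreover have "col (f u) \<noteq> col (f v)" if uv: "{u, v} \<in> edges H" for u v
  proof -
    have e: "{f u, f v} \<in> edges ?B" using f(2)[OF uv] .
    have np: "f u \<noteq> Inr p" "f v \<noteq> Inr p" using p(2) edge_endpoints[OF H uv] by (metis imageI)+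
    show ?thesis
    proof (cases "f u"; cases "f v")
      fix i j assume "f u = Inl i" "f v = Inl j"
      then show ?thesis using e by (simp add: col_def join_edge_Inl_Inl complete_graph_edge)
    next
      fix i j assume "f u = Inl i" "f v = Inr j"
      then show ?thesis using e by (simp add: col_def join_edge_Inl_Inr complete_graph_def)
    next
      fix i j assume "f u = Inr i" "f v = Inl j"
      then show ?thesis using e by (simp add: col_def insert_commute join_edge_Inl_Inr complete_graph_def)
    next
      fix i j assume "f u = Inr i" "f v = Inr j"
      then show ?thesis using e np cyc[of i j] by (simp add: col_def join_edge_Inr_Inr)
    qed
  qed
  ultimately show ?thesis unfolding partite_def by (intro exI[of _ "\<lambda>v. col (f v)"]) auto
qed

section \<open>Weighted blow-ups\<close>

text \<open>Given by a projection \<open>h\<close> of the new vertices rather than by fibre sizes: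
  copies of \<open>H\<close> can be pushed down along \<open>h\<close>, and the sizes are prescribed
  separately.\<close>

definition blow_up :: "'b graph \<Rightarrow> ('c \<Rightarrow> 'b) \<Rightarrow> 'c set \<Rightarrow> 'c graph" where
  "blow_up B h A = \<lparr>verts = A, edges = {{a, b} | a b. a \<in> A \<and> b \<in> A \<and> {h a, h b} \<in> edges B}\<rparr>"

lemma blow_up_edge: "{a, b} \<in> edges (blow_up B h A) \<longleftrightarrow> a \<in> A \<and> b \<in> A \<and> {h a, h b} \<in> edges B"
proof
  assume "{a, b} \<in> edges (blow_up B h A)"
  then obtain a' b' where "{a, b} = {a', b'}" "a' \<in> A" "b' \<in> A" "{h a', h b'} \<in> edges B"
    unfolding blow_up_def by auto
  then show "a \<in> A \<and> b \<in> A \<and> {h a, h b} \<in> edges B"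
    by (metis doubleton_eq_iff)
qed (auto simp: blow_up_def)

lemma verts_blow_up: "verts (blow_up B h A) = A"
  by (simp add: blow_up_def)

lemma simple_blow_up:
  assumes "simple_graph B" "finite A"
  shows "simple_graph (blow_up B h A)"
proof -
  have "a \<noteq> b" if "{h a, h b} \<in> edges B" for a b
    using edge_endpoints(3)[OF assms(1) that] by auto
  then show ?thesis using assms(2) unfolding simple_graph_def blow_up_def by auto
qed

text \<open>Host graphs have their vertices in \<open>nat\<close>, so pairs of a base vertex and an
  index below its weight are coded as numbers.\<close>

lemma exists_fibres:
  fixes w :: "'b :: countable \<Rightarrow> nat"
  assumes "finite X"
  obtains h :: "nat \<Rightarrow> 'b" and A where "finite A" "h ` A \<subseteq> X" "\<And>x. x \<in> X \<Longrightarrow> card {a \<in> A. h a = x} = w x"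
proof
  define h :: "nat \<Rightarrow> 'b" where "h a = fst (from_nat a :: 'b \<times> nat)" for a
  define A where "A = to_nat ` (SIGMA x:X. {..<w x})"
  show "finite A" unfolding A_def using assms by auto
  show "h ` A \<subseteq> X" unfolding A_def h_def by auto
  show "card {a \<in> A. h a = x} = w x" if "x \<in> X" for x
  proof -
    have "{a \<in> A. h a = x} = (\<lambda>i. to_nat (x, i)) ` {..<w x}"
      using that unfolding A_def h_def by auto
    moreover have "inj_on (\<lambda>i. to_nat (x, i)) {..<w x}" by (auto intro!: inj_onI)
    ultimately show ?thesis by (simp add: card_image)
  qed
qed

text \<open>A copy of \<open>H\<close> followed by the projection \<open>h\<close> is a homomorphism
  to \<open>B\<close>.\<close>

lemma graph_free_blow_up:
  assumes H: "simple_graph H" and hA: "h ` A \<subseteq> verts B" and nh: "\<not> homomorphic H B"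
  shows "graph_free H (blow_up B h A)"
  unfolding graph_free_def
proof
  assume "\<exists>F. subgraph_of F (blow_up B h A) \<and> isomorphic H F"
  then obtain F where F: "verts F \<subseteq> A" "edges F \<subseteq> edges (blow_up B h A)" "isomorphic H F"
    unfolding subgraph_of_def verts_blow_up by auto
  then obtain f where f: "bij_betw f (verts H) (verts F)"
    "\<forall>u\<in>verts H. \<forall>v\<in>verts H. {u, v} \<in> edges H \<longleftrightarrow> {f u, f v} \<in> edges F"
    unfolding isomorphic_def by auto
  have "(\<lambda>v. h (f v)) ` verts H \<subseteq> verts B"
    using F(1) bij_betwE[OF f(1)] hA by blast
  moreover have "{h (f u), h (f v)} \<in> edges B" if "{u, v} \<in> edges H" for u v
  proof -
    have "{f u, f v} \<in> edges F" using f(2) edge_endpoints[OF H that] that by simp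
    then show ?thesis using F(2) blow_up_edge[of "f u" "f v" B h A] by auto
  qed
  ultimately show False using nh unfolding homomorphic_def by blast
qed

lemma card_preimage_eq_sum:
  assumes "finite A" "finite X" "h ` A \<subseteq> X"
  shows "card {a \<in> A. Q (h a)} = (\<Sum>x\<in>{x \<in> X. Q x}. card {a \<in> A. h a = x})"
proof -
  have "{a \<in> A. Q (h a)} = (\<Union>x\<in>{x \<in> X. Q x}. {a \<in> A. h a = x})" using assms(3) by auto
  also have "card \<dots> = (\<Sum>x\<in>{x \<in> X. Q x}. card {a \<in> A. h a = x})"
    using assms by (intro card_UN_disjoint) auto
  finally show ?thesis .
qed

text \<open>Giving each vertex of \<open>B\<close> the majority colour of its fibre cannot colour \<open>B\<close> properly, and all
  edges between two adjacent fibres' majority classes of the same colour have to be deleted.\<close>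

lemma blow_up_far_from_partite:
  assumes B: "simple_graph B" "\<not> partite r B" and A: "finite A" "h ` A \<subseteq> verts B"
    and fibre: "\<And>x. x \<in> verts B \<Longrightarrow> q \<le> card {a \<in> A. h a = x}" and r: "0 < r"
    and D: "finite D" "partite r ((blow_up B h A)\<lparr>edges := edges (blow_up B h A) - D\<rparr>)"
  shows "q\<^sup>2 \<le> r\<^sup>2 * card D"
proof -
  obtain c where c: "c ` A \<subseteq> {..<r}" "\<And>u v. {u, v} \<in> edges (blow_up B h A) - D \<Longrightarrow> c u \<noteq> c v"
    using D(2) unfolding partite_def by (auto simp: verts_blow_up)
  define M where "M x i = {a \<in> A. h a = x \<and> c a = i}" for x i
  have "\<exists>i<r. q \<le> r * card (M x i)" if "x \<in> verts B" for x
  proof (rule ccontr)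
    assume "\<not> ?thesis"
    then have lt: "r * card (M x i) < q" if "i < r" for i using that by auto
    have "q \<le> card {a \<in> A. h a = x}" using fibre[OF that] .
    also have "{a \<in> A. h a = x} = (\<Union>i<r. M x i)" using c(1) unfolding M_def by auto
    also have "card \<dots> \<le> (\<Sum>i<r. card (M x i))" by (intro card_UN_le) simp
    finally have "r * q \<le> (\<Sum>i<r. r * card (M x i))" by (simp add: sum_distrib_left[symmetric])
    also have "\<dots> < (\<Sum>i<r. q)" using r lt by (intro sum_strict_mono) auto
    finally show False by simp
  qed
  then obtain k where k: "\<And>x. x \<in> verts B \<Longrightarrow> k x < r \<and> q \<le> r * card (M x (k x))" by metis
  have "\<not> (k ` verts B \<subseteq> {..<r} \<and> (\<forall>u v. {u, v} \<in> edges B \<longrightarrow> k u \<noteq> k v))"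
    using B(2) unfolding partite_def by blast
  then obtain x y where xy: "{x, y} \<in> edges B" "k x = k y" using k by blast
  have xyB: "x \<in> verts B" "y \<in> verts B" "x \<noteq> y" using edge_endpoints[OF B(1) xy(1)] by auto
  let ?P = "M x (k x) \<times> M y (k y)"
  have "inj_on (\<lambda>(a, b). {a, b}) ?P"
    using xyB(3) unfolding M_def inj_on_def by (auto simp: doubleton_eq_iff)
  moreover have "(\<lambda>(a, b). {a, b}) ` ?P \<subseteq> D"
  proof
    fix e assume "e \<in> (\<lambda>(a, b). {a, b}) ` ?P"
    then obtain a b where ab: "a \<in> M x (k x)" "b \<in> M y (k y)" "e = {a, b}" by auto
    have "{a, b} \<in> edges (blow_up B h A)" using ab xy unfolding M_def blow_up_edge by auto
    moreover have "c a = c b" using ab xy unfolding M_def by auto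
    ultimately show "e \<in> D" using c(2)[of a b] ab(3) by blast
  qed
  ultimately have "card ?P \<le> card D" using D(1) by (metis card_image card_mono)
  then have le: "card (M x (k x)) * card (M y (k y)) \<le> card D" by (simp add: card_cartesian_product)
  have "q * q \<le> (r * card (M x (k x))) * (r * card (M y (k y)))"
    using k xyB by (intro mult_mono) auto
  also have "\<dots> = r\<^sup>2 * (card (M x (k x)) * card (M y (k y)))" by (simp add: power2_eq_square)
  also have "\<dots> \<le> r\<^sup>2 * card D" using le by (rule mult_left_mono) simp
  finally show ?thesis by (simp add: power2_eq_square)
qed

text \<open>The blow-up weights \<open>2 * g - 1\<close> and \<open>1\<close> are those which make all degrees equal.\<close>

lemma weighted_degree_join_cycle:
  fixes k g q :: nat
  assumes g: "1 \<le> g"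
  defines "B \<equiv> graph_join (complete_graph k) (cycle_graph (2 * g + 1))"
  defines "w \<equiv> (\<lambda>x. case x of Inl (_ :: nat) \<Rightarrow> (2 * g - 1) * q | Inr (_ :: nat) \<Rightarrow> q)"
  shows "x \<in> verts B \<Longrightarrow> (k * (2 * g - 1) + 2) * q \<le> (\<Sum>y\<in>{y \<in> verts B. {y, x} \<in> edges B}. w y)"
    and "(\<Sum>y\<in>verts B. w y) = (k * (2 * g - 1) + (2 * g + 1)) * q"
proof -
  have fin: "finite (verts B)" unfolding B_def graph_join_def complete_graph_def cycle_graph_def by simp
  have vB: "verts B = {..<k} <+> {..<2 * g + 1}" unfolding B_def graph_join_def complete_graph_def cycle_graph_def by simp
  have plus: "(\<Sum>y\<in>I <+> J. w y) = card I * ((2 * g - 1) * q) + card J * q" if "finite I" "finite J" for I J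
    using that by (simp add: sum.Plus w_def)
  show "(\<Sum>y\<in>verts B. w y) = (k * (2 * g - 1) + (2 * g + 1)) * q"
    unfolding vB by (subst plus) (simp_all add: algebra_simps)
  assume x: "x \<in> verts B"
  \<comment> \<open>Exhibiting enough neighbours suffices for a lower bound. A vertex of the
    complete part misses only itself, a vertex of the cycle misses \<open>2 * g - 1\<close> vertices
    of the cycle including itself: weight \<open>(2 * g - 1) * q\<close> in both cases.\<close>
  have "\<exists>I J. finite I \<and> finite J \<and> I <+> J \<subseteq> {y \<in> verts B. {y, x} \<in> edges B} \<and>
      (k * (2 * g - 1) + 2) * q = card I * ((2 * g - 1) * q) + card J * q"
  proof (cases x)
    case (Inl i)
    then have i: "i < k" using x vB by auto
    have "({..<k} - {i}) <+> {..<2 * g + 1} \<subseteq> {y \<in> verts B. {y, x} \<in> edges B}"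
      using i unfolding vB unfolding Inl B_def
      by (auto simp: join_edge_Inl_Inl join_edge_Inl_Inr complete_graph_edge complete_graph_def cycle_graph_def
          insert_commute[of "Inr _" "Inl _"])
    moreover have "(k * (2 * g - 1) + 2) * q = card ({..<k} - {i}) * ((2 * g - 1) * q) + card {..<2 * g + 1} * q"
    proof -
      obtain k' g' where "k = Suc k'" "g = Suc g'" using i g by (metis Suc_le_D One_nat_def less_imp_Suc_add)
      then show ?thesis using i by (simp add: algebra_simps)
    qed
    ultimately show ?thesis by (intro exI[of _ "{..<k} - {i}"] exI[of _ "{..<2 * g + 1}"]) auto
  next
    case (Inr j)
    then have j: "j < 2 * g + 1" using x vB by auto
    define j1 where "j1 = (if j = 2 * g then 0 else Suc j)"
    define j2 where "j2 = (if j = 0 then 2 * g else j - 1)"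
    have j12: "j1 \<noteq> j2" "j1 < 2 * g + 1" "j2 < 2 * g + 1" using j g unfolding j1_def j2_def by auto
    have last: "{2 * g, 0} \<in> edges (cycle_graph (2 * g + 1))" using cycle_graph_edge_last[of "2 * g + 1"] by simp
    have "{j1, j} \<in> edges (cycle_graph (2 * g + 1))"
      using j last cycle_graph_edge_Suc[of j "2 * g + 1"] unfolding j1_def by (auto simp: insert_commute)
    moreover have "{j2, j} \<in> edges (cycle_graph (2 * g + 1))"
      using j last cycle_graph_edge_Suc[of "j - 1" "2 * g + 1"] unfolding j2_def by auto
    ultimately have "{..<k} <+> {j1, j2} \<subseteq> {y \<in> verts B. {y, x} \<in> edges B}"
      using j j12 unfolding vB unfolding Inr B_def
      by (auto simp: join_edge_Inr_Inr join_edge_Inl_Inr complete_graph_def cycle_graph_def)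
    moreover have "(k * (2 * g - 1) + 2) * q = card {..<k} * ((2 * g - 1) * q) + card {j1, j2} * q"
      using j12(1) by (simp add: algebra_simps)
    ultimately show ?thesis by (intro exI[of _ "{..<k}"] exI[of _ "{j1, j2}"]) auto
  qed
  then obtain I J where IJ: "finite I" "finite J" "I <+> J \<subseteq> {y \<in> verts B. {y, x} \<in> edges B}"
    "(k * (2 * g - 1) + 2) * q = card I * ((2 * g - 1) * q) + card J * q" by (elim exE conjE)
  then have "(k * (2 * g - 1) + 2) * q = (\<Sum>y\<in>I <+> J. w y)" using plus by simp
  with IJ(3) show "(k * (2 * g - 1) + 2) * q \<le> (\<Sum>y\<in>{y \<in> verts B. {y, x} \<in> edges B}. w y)"
    using fin by (simp add: sum_mono2)
qed

section \<open>Admissible minimum degree densities\<close>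

definition admissible_densities :: "'a graph \<Rightarrow> real set" where
  "admissible_densities H = {c :: real. \<forall>\<eta>>0. \<exists>n\<^sub>0 :: nat. \<forall>G :: nat graph.
     simple_graph G \<longrightarrow> graph_free H G \<longrightarrow> card (verts G) \<ge> n\<^sub>0 \<longrightarrow>
     real (min_degree G) \<ge> c * real (card (verts G)) \<longrightarrow>
     partite_after_deleting (chromatic_number H - 1) (\<eta> * (real (card (verts G)))\<^sup>2) G}"

lemma delta_threshold_eq: "delta_threshold H = Inf (admissible_densities H)"
  unfolding delta_threshold_def admissible_densities_def ..

lemma admissible_densities_upper:
  assumes "simple_graph H" "partite (r + 1) H" "chromatic_number H = r + 1" "2 \<le> r"
    and "1 - 1 / (real r - 1 / 3) < c" "c \<le> 1"
  shows "c \<in> admissible_densities H"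
  using minimum_degree_stability[where 'b = nat, OF assms(1,2,4,5,6)] assms(3)
  unfolding admissible_densities_def by simp

lemma admissible_densities_lower:
  fixes H :: "'a graph"
  assumes H: "simple_graph H" "chromatic_number H = r + 1" and r: "2 \<le> r" and g: "1 \<le> g"
    and nh: "\<not> homomorphic H (graph_join (complete_graph (r - 2)) (cycle_graph (2 * g + 1)))"
    and c: "c \<in> admissible_densities H"
  shows "1 - 1 / (real r - 1 + 2 / (2 * real g - 1)) < c"
proof (rule ccontr)
  assume "\<not> ?thesis"
  then have c_le: "c \<le> 1 - 1 / (real r - 1 + 2 / (2 * real g - 1))" by simp
  let ?B = "graph_join (complete_graph (r - 2)) (cycle_graph (2 * g + 1))"
  have B: "simple_graph ?B"
    using g by (intro simple_graph_join simple_complete_graph simple_cycle_graph) simp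
  then have finB: "finite (verts ?B)" by (simp add: simple_graph_def)
  define d where "d = (r - 2) * (2 * g - 1) + 2"
  define N where "N = (r - 2) * (2 * g - 1) + (2 * g + 1)"
  have N0: "0 < N" unfolding N_def by simp
  have bound: "1 - 1 / (real r - 1 + 2 / (2 * real g - 1)) = d / N"
  proof -
    have p: "0 < 2 * real g - 1" "0 \<le> (real r - 1) * (2 * real g - 1)" using g r by auto
    have "real r - 1 + 2 / (2 * real g - 1) = N / (2 * real g - 1)"
      using g r p unfolding N_def by (simp add: of_nat_diff field_simps)
    then have "1 - 1 / (real r - 1 + 2 / (2 * real g - 1)) = 1 - (2 * real g - 1) / N" by simp
    also have "\<dots> = (N - (2 * real g - 1)) / N" using N0 by (simp add: field_simps)
    also have "N - (2 * real g - 1) = d" unfolding N_def d_def using g by (simp add: of_nat_diff)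
    finally show ?thesis .
  qed
  \<comment> \<open>Making the blow-up \<open>r\<close>-partite costs at least
    \<open>(q / r)\<^sup>2\<close> edges, which for \<open>card A = N * q\<close> is
    \<open>2 * \<eta> * (card A)\<^sup>2\<close>, twice what is allowed.\<close>
  define \<eta> where "\<eta> = 1 / (2 * (real r * N)\<^sup>2)"
  have \<eta>: "0 < \<eta>" unfolding \<eta>_def using N0 r by simp
  then obtain n\<^sub>0 where n0: "\<And>G :: nat graph. simple_graph G \<Longrightarrow> graph_free H G \<Longrightarrow> card (verts G) \<ge> n\<^sub>0 \<Longrightarrow>
     real (min_degree G) \<ge> c * real (card (verts G)) \<Longrightarrow>
     partite_after_deleting r (\<eta> * (real (card (verts G)))\<^sup>2) G"
    using c H(2) unfolding admissible_densities_def by auto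
  \<comment> \<open>This makes the blow-up large enough and also gives \<open>0 < q\<close>, on
    which the final contradiction \<open>q\<^sup>2 \<le> q\<^sup>2 / 2\<close> rests.\<close>
  define q where "q = Suc n\<^sub>0"
  define w where "w = (\<lambda>x. case x of Inl (_ :: nat) \<Rightarrow> (2 * g - 1) * q | Inr (_ :: nat) \<Rightarrow> q)"
  obtain h :: "nat \<Rightarrow> nat + nat" and A where A: "finite A" "h ` A \<subseteq> verts ?B"
    and fibre: "\<And>x. x \<in> verts ?B \<Longrightarrow> card {a \<in> A. h a = x} = w x"
    by (rule exists_fibres[OF finB, of w]) (rule that)
  define G where "G = blow_up ?B h A"
  have count: "card {a \<in> A. Q (h a)} = (\<Sum>x\<in>{x \<in> verts ?B. Q x}. w x)" for Q
    using card_preimage_eq_sum[OF A(1) finB A(2), of Q] fibre by simp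
  note weights = weighted_degree_join_cycle[where k = "r - 2" and q = q, OF g, folded w_def]
  have cardA: "card A = N * q"
    using count[of "\<lambda>_. True"] weights(2) unfolding N_def by simp
  have "A \<noteq> {}" using cardA N0 unfolding q_def by auto
  have "d * q \<le> degree G a" if "a \<in> A" for a
  proof -
    have "degree G a = card {b \<in> A. {h b, h a} \<in> edges ?B}"
      unfolding degree_def G_def verts_blow_up blow_up_edge using that by (intro arg_cong[where f = card]) auto
    also have "\<dots> = (\<Sum>x\<in>{x \<in> verts ?B. {x, h a} \<in> edges ?B}. w x)" by (rule count)
    also have "\<dots> \<ge> d * q" unfolding d_def using A(2) that by (intro weights(1)) auto
    finally show ?thesis .
  qed
  then have "d * q \<le> min_degree G"
    unfolding min_degree_def using A(1) \<open>A \<noteq> {}\<close> by (simp add: G_def verts_blow_up)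
  then have "real d * q \<le> min_degree G" by (simp flip: of_nat_mult)
  moreover have "c * card A \<le> d / N * card A" using c_le bound by (intro mult_right_mono) auto
  ultimately have "c * card A \<le> min_degree G" using cardA N0 by simp
  moreover have "simple_graph G" unfolding G_def using B A(1) by (rule simple_blow_up)
  moreover have "graph_free H G" unfolding G_def using H(1) A(2) nh by (rule graph_free_blow_up)
  moreover have "n\<^sub>0 \<le> card A"
  proof -
    have "n\<^sub>0 \<le> 1 * q" unfolding q_def by simp
    also have "\<dots> \<le> N * q" using N0 by (intro mult_right_mono) auto
    finally show ?thesis using cardA by simp
  qed
  ultimately have "partite_after_deleting r (\<eta> * (real (card A))\<^sup>2) G"
    using n0[of G] by (simp add: G_def verts_blow_up)
  then obtain D where D: "D \<subseteq> edges G" "card D \<le> \<eta> * (real (card A))\<^sup>2" "partite r (G\<lparr>edges := edges G - D\<rparr>)"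
    unfolding partite_after_deleting_def by blast
  have "finite (edges G)" using \<open>simple_graph G\<close> unfolding simple_graph_def by (auto intro: finite_subset finite_imp_finite_nsets)
  then have "finite D" using D(1) finite_subset by blast
  have "q \<le> w x" for x
    using g unfolding w_def by (cases x) auto
  then have "q\<^sup>2 \<le> r\<^sup>2 * card D"
    using blow_up_far_from_partite[OF B not_partite_join_odd_cycle[OF r] A _ _ \<open>finite D\<close> D(3)[unfolded G_def], of q] fibre r
    by simp
  then have "(real q)\<^sup>2 \<le> (real r)\<^sup>2 * card D" by (simp flip: of_nat_mult of_nat_power)
  also have "\<dots> \<le> (real r)\<^sup>2 * (\<eta> * (real (card A))\<^sup>2)" using D(2) by (intro mult_left_mono) auto
  also have "\<dots> = (real q)\<^sup>2 / 2" unfolding \<eta>_def cardA using N0 r by (simp add: field_simps)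
  finally show False unfolding q_def by simp
qed

section \<open>The threshold\<close>

lemma partite_card_verts: "simple_graph H \<Longrightarrow> partite (card (verts H)) H"
proof -
  assume H: "simple_graph H"
  then obtain f where f: "bij_betw f (verts H) {0..<card (verts H)}"
    unfolding simple_graph_def using ex_bij_betw_finite_nat by blast
  have "f u \<noteq> f v" if "{u, v} \<in> edges H" for u v
    using edge_endpoints[OF H that] f unfolding bij_betw_def inj_on_def by blast
  then show ?thesis using f unfolding partite_def bij_betw_def by (intro exI[of _ f]) auto
qed

theorem theorem3p1:
  fixes H :: "'a graph" and r :: nat
  assumes "simple_graph H"
    and "chromatic_number H = r + 1"
    and "r + 1 \<ge> 3"
  shows "\<exists>g :: nat. g > 0 \<and>
      \<not> homomorphic H (graph_join (complete_graph (r - 2)) (cycle_graph (2 * g + 1))) \<and>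
      (\<forall>g'. 0 < g' \<and> g' < g \<longrightarrow>
        homomorphic H (graph_join (complete_graph (r - 2)) (cycle_graph (2 * g' + 1)))) \<and>
      1 - 1 / (real r - 1) < 1 - 1 / (real r - 1 + 2 / (2 * real g - 1)) \<and>
      1 - 1 / (real r - 1 + 2 / (2 * real g - 1)) \<le> delta_threshold H \<and>
      delta_threshold H \<le> 1 - 1 / (real r - 1 / 3)"
proof -
  have r: "2 \<le> r" using assms(3) by simp
  have part: "partite (r + 1) H"
    using LeastI[of "\<lambda>k. partite k H", OF partite_card_verts[OF assms(1)]] assms(2)
    unfolding chromatic_number_def by simp
  have npart: "\<not> partite r H"
    using not_less_Least[of r "\<lambda>k. partite k H"] assms(2) unfolding chromatic_number_def by simp
  define P where "P g \<longleftrightarrow> 0 < g \<and> \<not> homomorphic H (graph_join (complete_graph (r - 2)) (cycle_graph (2 * g + 1)))" for g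
  \<comment> \<open>The cycle then has \<open>2 * card (verts H) + 3\<close> vertices, more than
    \<open>H\<close>, so a homomorphism would yield an \<open>r\<close>-colouring of
    \<open>H\<close>.\<close>
  have "P (Suc (card (verts H)))"
    unfolding P_def using homomorphic_to_join_long_cycle_imp_partite[OF assms(1) _ _ r] npart by fastforce
  define g where "g = (LEAST g. P g)"
  have "P g" unfolding g_def using \<open>P (Suc _)\<close> by (rule LeastI)
  have g: "0 < g" and nh: "\<not> homomorphic H (graph_join (complete_graph (r - 2)) (cycle_graph (2 * g + 1)))"
    using \<open>P g\<close> unfolding P_def by auto
  have least: "homomorphic H (graph_join (complete_graph (r - 2)) (cycle_graph (2 * g' + 1)))" if "0 < g'" "g' < g" for g'
    using not_less_Least[of g' P] that unfolding g_def P_def by blast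
  define \<theta> where "\<theta> = 1 - 1 / (real r - 1 / 3)"
  define \<beta> where "\<beta> = 1 - 1 / (real r - 1 + 2 / (2 * real g - 1))"
  have upper: "c \<in> admissible_densities H" if "\<theta> < c" "c \<le> 1" for c
    using admissible_densities_upper[OF assms(1) part assms(2) r] that unfolding \<theta>_def .
  have lower: "\<beta> < c" if "c \<in> admissible_densities H" for c
    unfolding \<beta>_def by (rule admissible_densities_lower[OF assms(1,2) r _ nh that]) (use g in simp)
  have \<theta>1: "\<theta> < 1" unfolding \<theta>_def using r by simp
  \<comment> \<open>\<open>Inf\<close> on the reals is informative only for non-empty sets that are
    bounded below: \<open>1\<close> is admissible, and \<open>\<beta>\<close> is a lower
    bound.\<close>
  then have ne: "admissible_densities H \<noteq> {}" using upper[of 1] by auto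
  have bdd: "bdd_below (admissible_densities H)" using lower by (intro bdd_belowI[of _ \<beta>]) (auto intro: less_imp_le)
  have "\<beta> \<le> delta_threshold H"
    unfolding delta_threshold_eq using lower by (intro cInf_greatest[OF ne]) (auto intro: less_imp_le)
  moreover have "delta_threshold H \<le> \<theta>"
  proof (rule ccontr)
    assume *: "\<not> delta_threshold H \<le> \<theta>"
    \<comment> \<open>A point strictly between \<open>\<theta>\<close> and the threshold, capped at
      \<open>1\<close> because \<open>upper\<close> reaches only that far.\<close>
    define c where "c = min 1 ((\<theta> + delta_threshold H) / 2)"
    have "\<theta> < c" "c \<le> 1" "c < delta_threshold H" using * \<theta>1 unfolding c_def min_def by (auto simp: field_simps)
    then show False
      using cInf_lower[OF upper bdd, of c] unfolding delta_threshold_eq by auto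
  qed
  moreover have "1 - 1 / (real r - 1) < \<beta>"
  proof -
    have "0 < 2 / (2 * real g - 1)" "0 < real r - 1" using g r by simp_all
    then have "1 / (real r - 1 + 2 / (2 * real g - 1)) < 1 / (real r - 1)"
      by (intro divide_strict_left_mono mult_pos_pos add_pos_pos) simp_all
    then show ?thesis unfolding \<beta>_def by simp
  qed
  ultimately show ?thesis using g nh least unfolding \<theta>_def \<beta>_def by blast
qed

end
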